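(* Let $n\in\mathbb N$, $w>0$, $\overrightarrow{P}=(p_1,\dots,p_n)$ with $1\le p_1\le\cdots\le p_n<\infty$, and let $\chi$ be a kernel. For $f\in L^{\overrightarrow P}(\mathbb R^n)$ define the Kantorovich-type sampling operator $$K_w(f)(\mathbf x)=\sum_{\mathbf k\in\mathbb Z^n}\chi(w\mathbf x-\mathbf k)\,w^n\int_{I_{\mathbf k,w}}f(\mathbf t)\,d\mathbf t,\qquad I_{\mathbf k,w}=\prod_{j=1}^n\Big[\frac{k_j}{w},\frac{k_j+1}{w}\Big].$$ Then $K_w$ maps $L^{\overrightarrow P}(\mathbb R^n)$ into itself and $\|K_wf\|_{\overrightarrow P}\le (m_0(\chi))^{1-\frac1{p_n}}\|\chi\|_1^{\frac1{p_n}}\|f\|_{\overrightarrow P}$.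
   Context: A kernel is a function $\chi:\mathbb R^n\to\mathbb R$ with $\chi\in L^1(\mathbb R^n)$, bounded in a neighborhood of the origin, such that $\sum_{\mathbf k\in\mathbb Z^n}\chi(\mathbf u-\mathbf k)=1$ for every $\mathbf u\in\mathbb R^n$, and for a fixed $\alpha\ge0$ the absolute moment $m_\alpha(\chi):=\sup_{\mathbf u\in\mathbb R^n}\sum_{\mathbf k\in\mathbb Z^n}|\chi(\mathbf u-\mathbf k)|\,\|\mathbf u-\mathbf k\|_2^\alpha$ is finite; $m_0(\chi)=\sup_{\mathbf u}\sum_{\mathbf k}|\chi(\mathbf u-\mathbf k)|$. $L^{\overrightarrow P}(\mathbb R^n)$ is the space of measurable $f:\mathbb R^n\to\mathbb R$ with $\|f\|_{\overrightarrow P}=\Big(\int_{\mathbb R}\cdots\Big(\int_{\mathbb R}\Big(\int_{\mathbb R}|f(x_1,\dots,x_n)|^{p_1}dx_1\Big)^{p_2/p_1}dx_2\Big)^{p_3/p_2}\cdots dx_n\Big)^{1/p_n}<\infty$. *)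

theory Defs
  imports "HOL-Analysis.Analysis"
begin

text \<open>Points of R^n are extensional functions nat => real supported on {..<n};
  coordinate x_j of the paper is x (j-1).\<close>

definition lebn :: "nat \<Rightarrow> (nat \<Rightarrow> real) measure" where
  "lebn n = completion (PiM {..<n} (\<lambda>_. lborel))"

definition Zn :: "nat \<Rightarrow> (nat \<Rightarrow> int) set" where
  "Zn n = PiE {..<n} (\<lambda>_. UNIV)"

definition vsub :: "nat \<Rightarrow> (nat \<Rightarrow> real) \<Rightarrow> (nat \<Rightarrow> int) \<Rightarrow> (nat \<Rightarrow> real)" where
  "vsub n u k = (\<lambda>i\<in>{..<n}. u i - real_of_int (k i))"

definition eucl_norm :: "nat \<Rightarrow> (nat \<Rightarrow> real) \<Rightarrow> real" where
  "eucl_norm n u = L2_set u {..<n}"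

text \<open>absolute moment m_alpha (with the convention t^0 = 1, so m_0 is sup of sum |chi(u-k)|)\<close>
definition moment :: "nat \<Rightarrow> real \<Rightarrow> ((nat \<Rightarrow> real) \<Rightarrow> real) \<Rightarrow> ennreal" where
  "moment n \<alpha> \<kappa> = (SUP u \<in> space (lebn n).
      infsum (\<lambda>k. ennreal (\<bar>\<kappa> (vsub n u k)\<bar> *
         (if \<alpha> = 0 then 1 else eucl_norm n (vsub n u k) powr \<alpha>))) (Zn n))"

definition is_kernel :: "nat \<Rightarrow> real \<Rightarrow> ((nat \<Rightarrow> real) \<Rightarrow> real) \<Rightarrow> bool" where
  "is_kernel n \<alpha> \<kappa> \<longleftrightarrow>
     integrable (lebn n) \<kappa> \<and>
     (\<exists>\<delta>>0. \<exists>B. \<forall>u\<in>space (lebn n). eucl_norm n u < \<delta> \<longrightarrow> \<bar>\<kappa> u\<bar> \<le> B) \<and>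
     (\<forall>u\<in>space (lebn n). ((\<lambda>k. \<kappa> (vsub n u k)) has_sum 1) (Zn n)) \<and>
     moment n \<alpha> \<kappa> < \<infinity>"

definition epow :: "ennreal \<Rightarrow> real \<Rightarrow> ennreal" where
  "epow x r = (if x = \<infinity> then \<infinity> else ennreal (enn2real x powr r))"

fun mixed_iter :: "(nat \<Rightarrow> real) \<Rightarrow> ((nat \<Rightarrow> real) \<Rightarrow> real) \<Rightarrow> nat \<Rightarrow> (nat \<Rightarrow> real) \<Rightarrow> ennreal" where
  "mixed_iter p f 0 x = ennreal \<bar>f x\<bar>"
| "mixed_iter p f (Suc j) x =
     epow (\<integral>\<^sup>+ t. epow (mixed_iter p f j (x(j := t))) (p j) \<partial>lborel) (1 / p j)"

definition mixed_norm :: "nat \<Rightarrow> (nat \<Rightarrow> real) \<Rightarrow> ((nat \<Rightarrow> real) \<Rightarrow> real) \<Rightarrow> ennreal" where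
  "mixed_norm n p f = mixed_iter p f n (\<lambda>_. undefined)"

definition mixed_Lp :: "nat \<Rightarrow> (nat \<Rightarrow> real) \<Rightarrow> ((nat \<Rightarrow> real) \<Rightarrow> real) set" where
  "mixed_Lp n p = {f. f \<in> borel_measurable (lebn n) \<and> mixed_norm n p f < \<infinity>}"

definition cube :: "nat \<Rightarrow> real \<Rightarrow> (nat \<Rightarrow> int) \<Rightarrow> (nat \<Rightarrow> real) set" where
  "cube n w k = PiE {..<n} (\<lambda>i. {real_of_int (k i) / w .. (real_of_int (k i) + 1) / w})"

definition kantorovich :: "nat \<Rightarrow> real \<Rightarrow> ((nat \<Rightarrow> real) \<Rightarrow> real) \<Rightarrow> ((nat \<Rightarrow> real) \<Rightarrow> real)
    \<Rightarrow> (nat \<Rightarrow> real) \<Rightarrow> real" where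
  "kantorovich n w \<kappa> f x =
     infsum (\<lambda>k. \<kappa> (vsub n (\<lambda>i. w * x i) k) * w ^ n *
        (LINT t : cube n w k | lebn n. f t)) (Zn n)"

end

theory Submission
  imports Defs
begin

text \<open>
  Integrate out the coordinates one at a time. Write \<open>\<psi>\<^sub>j\<close> for the marginal of \<open>\<bar>\<kappa>\<bar>\<close> over the
  first \<open>j\<close> coordinates, \<open>G\<^sub>j\<close> and \<open>F\<^sub>j\<close> for the \<open>j\<close>-th iterated norms of \<open>f\<close> and
  \<open>K\<^sub>w f\<close>, \<open>c\<^sub>j(k)\<close> for the average of \<open>G\<^sub>j\<close> over the cell of \<open>k\<close> in the remaining coordinates,
  and \<open>M\<close> for the zeroth moment. By induction on \<open>j\<close>, with \<open>q = p\<^sub>j\<close> (and \<open>q = 1\<close> for \<open>j = 0\<close>),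
  \<open>F\<^sub>j(x)^q \<le> M^(q - 1) (\<Sum>k. \<psi>\<^sub>j(w x - k) c\<^sub>j(k)^q)\<close>.
  Periodizing \<open>\<psi>\<^sub>j\<close> keeps the bound \<open>M\<close>, so Jensen's inequality raises the exponent to
  \<open>p\<^sub>j\<^sub>+\<^sub>1 \<ge> p\<^sub>j\<close>; this is where monotonicity of the exponents enters. Minkowski's integral inequality
  then bounds the sum of \<open>c\<^sub>j(k)^r\<close>, \<open>r = p\<^sub>j\<^sub>+\<^sub>1\<close>, over the integrated lattice coordinate by
  \<open>w c\<^sub>j\<^sub>+\<^sub>1(k)^r\<close>.
  Taking \<open>j = n\<close> gives the theorem.

  Both \<open>f\<close> and \<open>\<kappa>\<close> are only Lebesgue measurable, but changing them on a null set does not affect the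
  iterated norms, so Borel representatives suffice.
\<close>

section \<open>Power means and the Minkowski inequality\<close>

lemma epow_mono: "r \<ge> 0 \<Longrightarrow> x \<le> y \<Longrightarrow> epow x r \<le> epow y r"
  by (auto simp: epow_def top_unique less_top intro!: ennreal_leI powr_mono2 enn2real_mono)

lemma epow_0_left [simp]: "epow 0 r = 0"
  by (simp add: epow_def)

lemma epow_top [simp]: "epow top r = top"
  by (simp add: epow_def)

lemma epow_one [simp]: "epow x 1 = x"
  by (cases x) (auto simp: epow_def)

lemma epow_ennreal: "x \<ge> 0 \<Longrightarrow> epow (ennreal x) r = ennreal (x powr r)"
  by (simp add: epow_def)

lemma epow_epow: "epow (epow x a) b = epow x (a * b)"
  by (simp add: epow_def powr_powr)

lemma epow_eq_top_iff [simp]: "epow x r = top \<longleftrightarrow> x = top"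
  by (auto simp: epow_def)

lemma epow_eq_0_iff [simp]: "epow x r = 0 \<longleftrightarrow> x = 0"
  by (cases x) (auto simp: epow_def)

text \<open>The conventions \<open>epow 0 r = 0\<close> and \<open>epow top r = top\<close> agree
  with \<open>0 * top = 0\<close>, so the identity survives the mixed cases of zero and
  infinity.\<close>

lemma epow_mult: "epow (x * y) r = epow x r * epow y r"
proof (cases "x = top \<or> y = top")
  case True
  then show ?thesis
    by (cases "x = 0"; cases "y = 0") (auto simp: ennreal_mult_eq_top_iff ennreal_top_mult ennreal_mult_top)
next
  case False
  then obtain a b where "a \<ge> 0" "b \<ge> 0" "x = ennreal a" "y = ennreal b"
    by (metis ennreal_cases infinity_ennreal_def)
  then show ?thesis
    by (simp add: ennreal_mult[symmetric] epow_ennreal powr_mult)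
qed

lemma borel_measurable_epow [measurable (raw)]:
  assumes "f \<in> borel_measurable M"
  shows "(\<lambda>x. epow (f x) r) \<in> borel_measurable M"
  unfolding epow_def using assms by measurable

text \<open>Convexity: the graph of the power lies above its tangent at \<open>m\<close>. Moving the
  negative term across makes the inequality meaningful in \<open>ennreal\<close>.\<close>

lemma young_tangent:
  fixes b m p :: real
  assumes "b \<ge> 0" "m > 0" "p \<ge> 1"
  shows "p * m powr (p - 1) * b \<le> b powr p + (p - 1) * m powr p"
proof (cases "b = 0")
  case True
  then show ?thesis using assms by simp
next
  case False
  have "(b powr p) powr (1/p) * (m powr p) powr (1 - 1/p) \<le> (1/p) * b powr p + (1 - 1/p) * m powr p"
    by (rule Youngs_inequality_0) (use assms False in auto)
  moreover have "p * (1 - 1/p) = p - 1"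
    using assms by (simp add: field_simps)
  then have "(b powr p) powr (1/p) * (m powr p) powr (1 - 1/p) = b * m powr (p - 1)"
    using assms by (simp add: powr_powr)
  ultimately have "b * m powr (p - 1) \<le> (1/p) * b powr p + (1 - 1/p) * m powr p"
    by simp
  then have "p * (b * m powr (p - 1)) \<le> p * ((1/p) * b powr p + (1 - 1/p) * m powr p)"
    using assms by (intro mult_left_mono) auto
  also have "\<dots> = b powr p + (p - 1) * m powr p"
    using assms by (simp add: distrib_left left_diff_distrib right_diff_distrib)
  finally show ?thesis by (simp add: ac_simps)
qed

lemma young_tangent_ennreal:
  assumes "m > 0" "p \<ge> 1"
  shows "ennreal (p * m powr (p - 1)) * b \<le> epow b p + ennreal ((p - 1) * m powr p)"
proof (cases b)
  case (real r)
  then show ?thesis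
    using young_tangent[of r m p] assms
    by (simp add: epow_ennreal ennreal_mult[symmetric] ennreal_plus[symmetric] ennreal_leI del: ennreal_plus)
qed simp

text \<open>Jensen's inequality for a density of total mass at most \<open>A\<close>: the tangent
  inequality is integrated first and the point of tangency is chosen afterwards. The mass enters
  only through an upper bound.\<close>

lemma nn_integral_power_mean:
  assumes [measurable]: "\<phi> \<in> borel_measurable M" "b \<in> borel_measurable M"
    and A: "(\<integral>\<^sup>+x. \<phi> x \<partial>M) \<le> ennreal A" "A > 0" and p: "p \<ge> 1"
  shows "epow (\<integral>\<^sup>+x. \<phi> x * b x \<partial>M) p \<le> ennreal (A powr (p - 1)) * (\<integral>\<^sup>+x. \<phi> x * epow (b x) p \<partial>M)"
proof -
  define B where "B = (\<integral>\<^sup>+x. \<phi> x * b x \<partial>M)"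
  define C where "C = (\<integral>\<^sup>+x. \<phi> x * epow (b x) p \<partial>M)"
  have tangent: "ennreal (p * m powr (p - 1)) * B \<le> C + ennreal ((p - 1) * m powr p) * ennreal A"
    if m: "m > 0" for m
  proof -
    have "ennreal (p * m powr (p - 1)) * B = (\<integral>\<^sup>+x. \<phi> x * (ennreal (p * m powr (p - 1)) * b x) \<partial>M)"
      unfolding B_def by (subst nn_integral_cmult[symmetric]) (auto simp: ac_simps)
    also have "\<dots> \<le> (\<integral>\<^sup>+x. \<phi> x * (epow (b x) p + ennreal ((p - 1) * m powr p)) \<partial>M)"
      by (intro nn_integral_mono mult_left_mono young_tangent_ennreal m p) auto
    also have "\<dots> = C + (\<integral>\<^sup>+x. ennreal ((p - 1) * m powr p) * \<phi> x \<partial>M)"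
      unfolding C_def by (subst nn_integral_add[symmetric]) (auto simp: distrib_left ac_simps)
    also have "\<dots> = C + ennreal ((p - 1) * m powr p) * (\<integral>\<^sup>+x. \<phi> x \<partial>M)"
      by (simp add: nn_integral_cmult)
    also have "\<dots> \<le> C + ennreal ((p - 1) * m powr p) * ennreal A"
      by (intro add_left_mono mult_left_mono A) auto
    finally show ?thesis .
  qed
  have "epow B p \<le> ennreal (A powr (p - 1)) * C"
  proof (cases "C = top")
    case True
    then show ?thesis using A by (simp add: ennreal_mult_top)
  next
    case False
    then obtain c where c: "C = ennreal c" "c \<ge> 0" by (cases C) auto
    \<comment> \<open>The tangent at 1 shows that \<open>B\<close> is finite when \<open>C\<close>
      is.\<close>
    have "ennreal (p * 1 powr (p - 1)) * B < top"
      using tangent[of 1] c by (simp add: ennreal_mult[symmetric] ennreal_plus[symmetric] p A order_less_le_trans top.not_eq_extremum del: ennreal_plus)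
         (metis ennreal_less_top ennreal_mult ennreal_add_eq_top le_less_trans ennreal_mult_eq_top_iff ennreal_neq_top top.not_eq_extremum)
    then have "B < top" using p by (auto simp: ennreal_mult_less_top)
    then obtain r where r: "B = ennreal r" "r \<ge> 0" by (cases B) auto
    show ?thesis
    proof (cases "r = 0")
      case True
      then show ?thesis using r by simp
    next
      case False
      then have "r > 0" using r by simp
      \<comment> \<open>This point of tangency gives the best lower bound for \<open>C\<close>; it
        is the mean of \<open>b\<close> when the mass is exactly \<open>A\<close>.\<close>
      define m where "m = r / A"
      have m: "m > 0" using \<open>r > 0\<close> A by (simp add: m_def)
      have rA: "r = m * A" using A by (simp add: m_def)
      have "ennreal (p * m powr (p - 1) * r) \<le> ennreal (c + (p - 1) * m powr p * A)"
        using tangent[OF m] r c A p by (simp add: ennreal_mult[symmetric] ennreal_plus[symmetric] del: ennreal_plus)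
      then have "p * m powr (p - 1) * r \<le> c + (p - 1) * m powr p * A"
        by (subst (asm) ennreal_le_iff) (use c A p in auto)
      moreover have "p * m powr (p - 1) * r = p * m powr p * A"
        using m unfolding rA by (simp add: powr_diff)
      ultimately have "p * m powr p * A \<le> c + (p - 1) * m powr p * A"
        by linarith
      then have "m powr p * A \<le> c"
        by (simp add: algebra_simps)
      then have "A powr (p - 1) * (m powr p * A) \<le> A powr (p - 1) * c"
        by (intro mult_left_mono) auto
      moreover have "A powr (p - 1) * (m powr p * A) = r powr p"
        using A m unfolding rA by (simp add: powr_mult powr_diff)
      ultimately show ?thesis
        using r c by (simp add: epow_ennreal ennreal_mult[symmetric])
    qed
  qed
  then show ?thesis by (simp add: B_def C_def)
qed

text \<open>Jensen's inequality for \<open>h m / N\<close> with respect to the measure of density \<open>N\<close>.\<close>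

lemma nn_integral_minkowski:
  fixes h :: "'i \<Rightarrow> 'a \<Rightarrow> ennreal"
  assumes I: "countable I" and [measurable]: "\<And>m. h m \<in> borel_measurable M" "N \<in> borel_measurable M"
    and p: "p \<ge> 1"
    and le: "\<And>x. x \<in> space M \<Longrightarrow> (\<integral>\<^sup>+m. epow (h m x) p \<partial>count_space I) \<le> epow (N x) p"
  shows "(\<integral>\<^sup>+m. epow (\<integral>\<^sup>+x. h m x \<partial>M) p \<partial>count_space I) \<le> epow (\<integral>\<^sup>+x. N x \<partial>M) p"
proof -
  define A where "A = (\<integral>\<^sup>+x. N x \<partial>M)"
  have h0: "h m x = 0" if "x \<in> space M" "N x = 0" "m \<in> I" for m x
  proof -
    have "(\<integral>\<^sup>+m. epow (h m x) p \<partial>count_space I) = 0"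
      using le[OF that(1)] that by simp
    then have "\<forall>m\<in>I. epow (h m x) p = 0"
      by (subst (asm) nn_integral_0_iff_AE) (auto simp: AE_count_space)
    then show ?thesis using that by simp
  qed
  consider "A = top" | "A = 0" | "A \<noteq> top" "A \<noteq> 0" by blast
  then show ?thesis
  proof cases
    case 1
    then show ?thesis by (simp add: A_def)
  next
    case 2
    then have "AE x in M. N x = 0"
      unfolding A_def by (subst (asm) nn_integral_0_iff_AE) auto
    then have "(\<integral>\<^sup>+x. h m x \<partial>M) = 0" if "m \<in> I" for m
      by (subst nn_integral_0_iff_AE) (use that h0 in auto)
    then have "(\<integral>\<^sup>+m. epow (\<integral>\<^sup>+x. h m x \<partial>M) p \<partial>count_space I) = (\<integral>\<^sup>+m. 0 \<partial>count_space I)"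
      by (intro nn_integral_cong) auto
    then show ?thesis by simp
  next
    case 3
    then obtain a where a: "A = ennreal a" "a > 0"
      by (cases A) (auto simp: less_le)
    \<comment> \<open>Almost everywhere \<open>N x\<close> is finite, and by \<open>h0\<close> its
      zeros are zeros of \<open>h m x\<close>. Hence \<open>h m x = N x * (h m x / N x)\<close>
      almost everywhere.\<close>
    have fin: "AE x in M. N x \<noteq> top"
      using 3 unfolding A_def by (intro nn_integral_noteq_infinite[unfolded infinity_ennreal_def]) auto
    have "(\<integral>\<^sup>+m. epow (\<integral>\<^sup>+x. h m x \<partial>M) p \<partial>count_space I)
      \<le> (\<integral>\<^sup>+m. ennreal (a powr (p - 1)) * (\<integral>\<^sup>+x. N x * epow (h m x / N x) p \<partial>M) \<partial>count_space I)"
    proof (intro nn_integral_mono)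
      fix m assume "m \<in> space (count_space I)"
      then have "m \<in> I" by simp
      have "(\<integral>\<^sup>+x. h m x \<partial>M) = (\<integral>\<^sup>+x. N x * (h m x / N x) \<partial>M)"
      proof (intro nn_integral_cong_AE)
        show "AE x in M. h m x = N x * (h m x / N x)"
          using fin AE_space
        proof eventually_elim
          case (elim x)
          then show ?case
            using h0[of x m] \<open>m \<in> I\<close>
            by (cases "N x = 0") (auto simp: ennreal_times_divide ennreal_mult_divide_eq mult.commute[of "N x"])
        qed
      qed
      also have "epow \<dots> p \<le> ennreal (a powr (p - 1)) * (\<integral>\<^sup>+x. N x * epow (h m x / N x) p \<partial>M)"
        by (rule nn_integral_power_mean) (use a A_def p in auto)
      finally show "epow (\<integral>\<^sup>+x. h m x \<partial>M) p \<le> ennreal (a powr (p - 1)) * (\<integral>\<^sup>+x. N x * epow (h m x / N x) p \<partial>M)" .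
    qed
    \<comment> \<open>Countability of \<open>I\<close> lets the sum pass inside the integral, where
      \<open>le\<close> bounds it by \<open>N x\<close>.\<close>
    also have "\<dots> = ennreal (a powr (p - 1)) * (\<integral>\<^sup>+x. (\<integral>\<^sup>+m. N x * epow (h m x / N x) p \<partial>count_space I) \<partial>M)"
      by (subst nn_integral_cmult, simp, subst nn_integral_count_space_nn_integral) (use I in auto)
    also have "\<dots> \<le> ennreal (a powr (p - 1)) * (\<integral>\<^sup>+x. N x \<partial>M)"
    proof (intro mult_left_mono nn_integral_mono_AE)
      show "AE x in M. (\<integral>\<^sup>+m. N x * epow (h m x / N x) p \<partial>count_space I) \<le> N x"
        using fin AE_space
      proof eventually_elim
        case (elim x)
        show ?case
        proof (cases "N x = 0")
          case False
          then obtain r where r: "N x = ennreal r" "r > 0"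
            using elim by (cases "N x") (auto simp: less_le)
          have *: "epow (h m x / N x) p = ennreal (1 / r powr p) * epow (h m x) p" for m
          proof -
            have "h m x / N x = ennreal (1 / r) * h m x"
              using r by (simp add: divide_ennreal_def inverse_ennreal inverse_eq_divide mult.commute)
            then show ?thesis
              using r by (simp add: epow_mult epow_ennreal powr_divide)
          qed
          have "(\<integral>\<^sup>+m. N x * epow (h m x / N x) p \<partial>count_space I)
            = N x * (ennreal (1 / r powr p) * (\<integral>\<^sup>+m. epow (h m x) p \<partial>count_space I))"
            unfolding * by (simp add: nn_integral_cmult)
          also have "\<dots> \<le> N x * (ennreal (1 / r powr p) * epow (N x) p)"
            by (intro mult_left_mono le elim) auto
          also have "\<dots> = N x"
            using r by (simp add: epow_ennreal ennreal_mult[symmetric])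
          finally show ?thesis .
        qed auto
      qed
    qed auto
    also have "\<dots> = epow A p"
      using a by (simp add: A_def[symmetric] epow_ennreal ennreal_mult[symmetric] powr_diff)
    finally show ?thesis by (simp add: A_def)
  qed
qed

section \<open>Iterated integrals and lattice sums\<close>

abbreviation lborel_on :: "nat set \<Rightarrow> (nat \<Rightarrow> real) measure" where
  "lborel_on I \<equiv> PiM I (\<lambda>_. lborel)"

section \<open>Tonelli's theorem and null sets, one coordinate at a time\<close>

lemma nn_integral_lborel_on_insert:
  assumes "finite I" "i \<notin> I" "f \<in> borel_measurable (lborel_on (insert i I))"
  shows "(\<integral>\<^sup>+x. f x \<partial>lborel_on (insert i I)) = (\<integral>\<^sup>+x. (\<integral>\<^sup>+t. f (x(i := t)) \<partial>lborel) \<partial>lborel_on I)"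
proof -
  interpret product_sigma_finite "\<lambda>_::nat. lborel :: real measure" by standard
  show ?thesis using product_nn_integral_insert[OF assms] .
qed

text \<open>Tonelli's theorem for the indicator of a null set shows that almost every section of it
  is null.\<close>

lemma AE_lborel_on_insert:
  assumes "finite I" "i \<notin> I" "AE x in lborel_on (insert i I). P x"
  shows "AE x in lborel_on I. AE t in lborel. P (x(i := t))"
proof -
  obtain N where N: "{x \<in> space (lborel_on (insert i I)). \<not> P x} \<subseteq> N"
    "N \<in> null_sets (lborel_on (insert i I))"
    using assms(3) by (auto elim!: AE_E simp: null_sets_def)
  then have N_sets [measurable]: "N \<in> sets (lborel_on (insert i I))" by auto
  have "(\<integral>\<^sup>+x. (\<integral>\<^sup>+t. indicator N (x(i := t)) \<partial>lborel) \<partial>lborel_on I) = 0"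
    by (subst nn_integral_lborel_on_insert[symmetric]) (use assms N in auto)
  then have "AE x in lborel_on I. (\<integral>\<^sup>+t. indicator N (x(i := t)) \<partial>lborel) = 0"
    by (subst (asm) nn_integral_0_iff_AE) measurable
  then show ?thesis
    using AE_space
  proof eventually_elim
    case (elim x)
    have "AE t in lborel. (indicator N (x(i := t)) :: ennreal) = 0"
    proof -
      have "(\<lambda>t. indicator N (x(i := t)) :: ennreal) \<in> borel_measurable lborel"
        using measurable_comp[OF measurable_component_update[OF elim(2) assms(2)] borel_measurable_indicator[OF N_sets]]
        by (simp add: comp_def)
      then show ?thesis
        using elim by (subst (asm) nn_integral_0_iff_AE) auto
    qed
    then show ?case
    proof eventually_elim
      case (elim t)
      have "x(i := t) \<in> space (lborel_on (insert i I))"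
        using \<open>x \<in> space (lborel_on I)\<close> by (auto simp: space_PiM PiE_def extensional_def)
      with elim N show ?case by (auto simp: indicator_def split: if_splits)
    qed
  qed
qed

text \<open>One family covers the translates \<open>u - k\<close> (scale 1) and the sampling
  arguments \<open>w x - k\<close> (scale \<open>w\<close>). The index set \<open>I\<close> shrinks
  as coordinates are integrated out.\<close>

definition lattice_shift :: "nat set \<Rightarrow> real \<Rightarrow> (nat \<Rightarrow> real) \<Rightarrow> (nat \<Rightarrow> int) \<Rightarrow> nat \<Rightarrow> real" where
  "lattice_shift I a x k = (\<lambda>i\<in>I. a * x i - real_of_int (k i))"

lemma vsub_eq_lattice_shift: "vsub n (\<lambda>i. a * x i) k = lattice_shift {..<n} a x k"
  by (simp add: vsub_def lattice_shift_def)

lemma vsub_eq_lattice_shift_1: "vsub n u k = lattice_shift {..<n} 1 u k"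
  by (simp add: vsub_def lattice_shift_def)

lemma lattice_shift_insert:
  "i \<notin> I \<Longrightarrow> lattice_shift (insert i I) a (x(i := t)) (k(i := m)) = (lattice_shift I a x k)(i := a * t - of_int m)"
  by (auto simp: lattice_shift_def fun_eq_iff)

lemma measurable_lattice_shift [measurable]:
  "(\<lambda>x. lattice_shift I a x k) \<in> lborel_on I \<rightarrow>\<^sub>M lborel_on I"
  unfolding lattice_shift_def by measurable

lemma lattice_shift_space [simp]: "lattice_shift I a x k \<in> space (lborel_on I)"
  by (auto simp: lattice_shift_def space_PiM)

lemma nn_integral_lborel_affine:
  fixes f :: "real \<Rightarrow> ennreal"
  assumes "f \<in> borel_measurable borel" "a > 0"
  shows "ennreal a * (\<integral>\<^sup>+t. f (a * t - b) \<partial>lborel) = (\<integral>\<^sup>+t. f t \<partial>lborel)"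
  using nn_integral_real_affine[of f a "-b"] assms by simp

text \<open>Each coordinate contributes one factor \<open>a\<close> to the Jacobian; the integer
  shift contributes none, by translation invariance.\<close>

lemma nn_integral_lattice_shift:
  assumes "finite I" "f \<in> borel_measurable (lborel_on I)" "a > 0"
  shows "ennreal (a ^ card I) * (\<integral>\<^sup>+x. f (lattice_shift I a x k) \<partial>lborel_on I) = (\<integral>\<^sup>+x. f x \<partial>lborel_on I)"
  using assms
proof (induction I arbitrary: f rule: finite_induct)
  case empty
  then show ?case by (simp add: PiM_empty nn_integral_count_space_finite lattice_shift_def)
next
  case (insert i I)
  note [measurable] = insert.prems(1)
  have k: "k = k(i := k i)" by simp
  define F where "F x = (\<integral>\<^sup>+t. f (x(i := t)) \<partial>lborel)" for x
  have [measurable]: "F \<in> borel_measurable (lborel_on I)"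
    unfolding F_def by measurable
  have 1: "ennreal a * (\<integral>\<^sup>+t. f (lattice_shift (insert i I) a (x(i := t)) k) \<partial>lborel) = F (lattice_shift I a x k)" for x
  proof -
    have "(\<lambda>t. f ((lattice_shift I a x k)(i := t))) \<in> borel_measurable lborel"
      using measurable_comp[OF measurable_component_update insert.prems(1)] \<open>i \<notin> I\<close>
      by (simp add: comp_def)
    then have "ennreal a * (\<integral>\<^sup>+t. f ((lattice_shift I a x k)(i := a * t - of_int (k i))) \<partial>lborel) = F (lattice_shift I a x k)"
      unfolding F_def using nn_integral_lborel_affine[of "\<lambda>t. f ((lattice_shift I a x k)(i := t))"] insert.prems by simp
    then show ?thesis
      by (subst k, subst lattice_shift_insert) (use insert in auto)
  qed
  have "ennreal (a ^ card (insert i I)) * (\<integral>\<^sup>+x. f (lattice_shift (insert i I) a x k) \<partial>lborel_on (insert i I))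
    = ennreal (a ^ card I) * (ennreal a * (\<integral>\<^sup>+x. (\<integral>\<^sup>+t. f (lattice_shift (insert i I) a (x(i := t)) k) \<partial>lborel) \<partial>lborel_on I))"
    by (subst nn_integral_lborel_on_insert) (use insert in \<open>auto simp: ennreal_mult[symmetric] mult.assoc[symmetric] mult.commute\<close>)
  also have "\<dots> = ennreal (a ^ card I) * (\<integral>\<^sup>+x. F (lattice_shift I a x k) \<partial>lborel_on I)"
    by (subst nn_integral_cmult[symmetric]) (use 1 in auto)
  also have "\<dots> = (\<integral>\<^sup>+x. F x \<partial>lborel_on I)"
    using insert.prems by (intro insert.IH) auto
  also have "\<dots> = (\<integral>\<^sup>+x. f x \<partial>lborel_on (insert i I))"
    unfolding F_def by (rule nn_integral_lborel_on_insert[symmetric]) (use insert in auto)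
  finally show ?case .
qed

text \<open>By the change of variables, preimages of null sets are null. This permits Borel
  representatives at the arguments \<open>w x - k\<close>.\<close>

lemma AE_lattice_shift:
  assumes "finite I" "a > 0" "AE x in lborel_on I. P x"
  shows "AE x in lborel_on I. P (lattice_shift I a x k)"
proof -
  obtain N where N: "{x \<in> space (lborel_on I). \<not> P x} \<subseteq> N" "N \<in> null_sets (lborel_on I)"
    using assms(3) by (auto elim!: AE_E simp: null_sets_def)
  then have [measurable]: "N \<in> sets (lborel_on I)" by auto
  have "ennreal (a ^ card I) * (\<integral>\<^sup>+x. indicator N (lattice_shift I a x k) \<partial>lborel_on I) = 0"
    by (subst nn_integral_lattice_shift) (use assms N in auto)
  then have "(\<integral>\<^sup>+x. indicator N (lattice_shift I a x k) \<partial>lborel_on I) = 0"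
    using assms by auto
  then have "AE x in lborel_on I. (indicator N (lattice_shift I a x k) :: ennreal) = 0"
    by (subst (asm) nn_integral_0_iff_AE) measurable
  then show ?thesis
  proof eventually_elim
    case (elim x)
    then have "lattice_shift I a x k \<notin> N" by (auto simp: indicator_def split: if_splits)
    then show ?case using N(1) lattice_shift_space[of I a x k] by blast
  qed
qed

text \<open>Values in \<open>ennreal\<close> admit majorants that may be infinite. With all
  exponents equal to 1 the recursion produces the marginal over the first \<open>j\<close>
  coordinates.\<close>

fun emixed_iter :: "(nat \<Rightarrow> real) \<Rightarrow> ((nat \<Rightarrow> real) \<Rightarrow> ennreal) \<Rightarrow> nat \<Rightarrow> (nat \<Rightarrow> real) \<Rightarrow> ennreal" where
  "emixed_iter p F 0 x = F x"
| "emixed_iter p F (Suc j) x =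
     epow (\<integral>\<^sup>+ t. epow (emixed_iter p F j (x(j := t))) (p j) \<partial>lborel) (1 / p j)"

lemma mixed_iter_eq_emixed_iter: "mixed_iter p f j x = emixed_iter p (\<lambda>x. ennreal \<bar>f x\<bar>) j x"
  by (induction j arbitrary: x) auto

lemma atLeastLessThan_insert: "j < n \<Longrightarrow> {j..<n} = insert j {Suc j..<n}"
  by auto

lemma measurable_emixed_iter:
  assumes "F \<in> borel_measurable (lborel_on {..<n})" "j \<le> n"
  shows "emixed_iter p F j \<in> borel_measurable (lborel_on {j..<n})"
  using assms(2)
proof (induction j)
  case 0
  have "emixed_iter p F 0 = F" by auto
  then show ?case using assms by (simp add: lessThan_atLeast0)
next
  case (Suc j)
  then have [measurable]: "emixed_iter p F j \<in> borel_measurable (lborel_on (insert j {Suc j..<n}))"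
    by (simp add: atLeastLessThan_insert[symmetric])
  show ?case
    unfolding emixed_iter.simps by measurable
qed

text \<open>No measurability is assumed: the non-negative integral is then a lower integral, which is still
  monotone almost everywhere.\<close>

lemma emixed_iter_mono_AE:
  assumes "AE x in lborel_on {..<n}. F x \<le> G x" "\<And>i. i < n \<Longrightarrow> p i > 0" "j \<le> n"
  shows "AE x in lborel_on {j..<n}. emixed_iter p F j x \<le> emixed_iter p G j x"
  using assms(3)
proof (induction j)
  case 0
  then show ?case using assms(1) by (simp only: emixed_iter.simps lessThan_atLeast0)
next
  case (Suc j)
  then have "AE x in lborel_on (insert j {Suc j..<n}). emixed_iter p F j x \<le> emixed_iter p G j x"
    unfolding atLeastLessThan_insert[OF Suc_le_lessD[OF Suc.prems]] by simp
  then have "AE x in lborel_on {Suc j..<n}. AE t in lborel. emixed_iter p F j (x(j := t)) \<le> emixed_iter p G j (x(j := t))"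
    by (rule AE_lborel_on_insert[rotated 2]) auto
  then show ?case
  proof eventually_elim
    case (elim x)
    have "p j > 0" using Suc assms by simp
    then show ?case
      unfolding emixed_iter.simps
      by (intro epow_mono nn_integral_mono_AE) (use elim in \<open>auto elim!: eventually_mono intro!: epow_mono\<close>)
  qed
qed

section \<open>Lattice sums and the tiling of the line\<close>

lemma nn_integral_count_space_PiE_insert:
  fixes f :: "(nat \<Rightarrow> int) \<Rightarrow> ennreal"
  assumes "finite I" "i \<notin> I"
  shows "(\<integral>\<^sup>+k. f k \<partial>count_space (PiE (insert i I) (\<lambda>_. UNIV)))
    = (\<integral>\<^sup>+k. (\<integral>\<^sup>+m. f (k(i := m)) \<partial>count_space UNIV) \<partial>count_space (PiE I (\<lambda>_. UNIV)))"
proof -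
  interpret product_sigma_finite "\<lambda>_::nat. count_space (UNIV :: int set)"
    by (intro product_sigma_finite.intro sigma_finite_measure_count_space_countable) auto
  have *: "PiM J (\<lambda>_. count_space UNIV) = count_space (PiE J (\<lambda>_. UNIV :: int set))"
    if "finite J" for J :: "nat set"
    by (rule count_space_PiM_finite) (use that in auto)
  show ?thesis
    using product_nn_integral_insert[of I i f] assms by (simp add: *)
qed

text \<open>The closed cells overlap only in grid points, which form a countable and hence null set;
  every other point lies in exactly one cell.\<close>

lemma nn_integral_cells:
  fixes h :: "real \<Rightarrow> ennreal"
  assumes [measurable]: "h \<in> borel_measurable borel" and w: "w > 0"
  shows "(\<integral>\<^sup>+m. (\<integral>\<^sup>+t. h t * indicator {real_of_int m / w..(real_of_int m + 1) / w} t \<partial>lborel) \<partial>count_space UNIV)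
    = (\<integral>\<^sup>+t. h t \<partial>lborel)"
proof -
  have "countable (range (\<lambda>m. real_of_int m / w))" by simp
  then have "AE t in lborel. t \<notin> range (\<lambda>m. real_of_int m / w)"
    by (intro AE_not_in countable_imp_null_set_lborel)
  then have ae: "AE t in lborel. (\<integral>\<^sup>+m. h t * indicator {real_of_int m / w..(real_of_int m + 1) / w} t \<partial>count_space UNIV) = h t"
  proof eventually_elim
    case (elim t)
    have "t \<in> {real_of_int m / w..(real_of_int m + 1) / w} \<longleftrightarrow> m = \<lfloor>w * t\<rfloor>" for m
    proof -
      have "t \<noteq> real_of_int (m + 1) / w" using elim by blast
      then have "t \<in> {real_of_int m / w..(real_of_int m + 1) / w} \<longleftrightarrow> real_of_int m / w \<le> t \<and> t < (real_of_int m + 1) / w"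
        by auto
      also have "\<dots> \<longleftrightarrow> real_of_int m \<le> w * t \<and> w * t < real_of_int m + 1"
        using w by (simp add: field_simps)
      also have "\<dots> \<longleftrightarrow> m = \<lfloor>w * t\<rfloor>" by linarith
      finally show ?thesis .
    qed
    then have "(\<lambda>m. h t * indicator {real_of_int m / w..(real_of_int m + 1) / w} t) = (\<lambda>m. h t * indicator {\<lfloor>w * t\<rfloor>} m)"
      by (auto simp: fun_eq_iff indicator_def)
    then show ?case
      by (simp add: nn_integral_cmult)
  qed
  have "(\<integral>\<^sup>+m. (\<integral>\<^sup>+t. h t * indicator {real_of_int m / w..(real_of_int m + 1) / w} t \<partial>lborel) \<partial>count_space UNIV)
    = (\<integral>\<^sup>+t. (\<integral>\<^sup>+m. h t * indicator {real_of_int m / w..(real_of_int m + 1) / w} t \<partial>count_space UNIV) \<partial>lborel)"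
    by (rule nn_integral_count_space_nn_integral[symmetric]) auto
  also have "\<dots> = (\<integral>\<^sup>+t. h t \<partial>lborel)"
    by (rule nn_integral_cong_AE[OF ae])
  finally show ?thesis .
qed

text \<open>Unordered sums become integrals over counting measure, so that Tonelli's theorem applies
  to them. Finite subsums give one inequality, an enumeration of \<open>A\<close> the other.\<close>

lemma infsum_ennreal_eq_nn_integral:
  fixes f :: "'a \<Rightarrow> ennreal"
  assumes "countable A"
  shows "infsum f A = (\<integral>\<^sup>+x. f x \<partial>count_space A)"
proof (rule antisym)
  have "infsum f A = (SUP F\<in>{F. finite F \<and> F \<subseteq> A}. sum f F)"
    by (rule nonneg_infsum_complete) auto
  also have "\<dots> \<le> (\<integral>\<^sup>+x. f x \<partial>count_space A)"
  proof (rule SUP_least)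
    fix F assume F: "F \<in> {F. finite F \<and> F \<subseteq> A}"
    then have "sum f F = (\<integral>\<^sup>+x. f x * indicator F x \<partial>count_space A)"
      by (subst nn_integral_count_space'[of F]) (auto simp: indicator_def)
    also have "\<dots> \<le> (\<integral>\<^sup>+x. f x \<partial>count_space A)"
      by (intro nn_integral_mono) (auto simp: indicator_def)
    finally show "sum f F \<le> (\<integral>\<^sup>+x. f x \<partial>count_space A)" .
  qed
  finally show "infsum f A \<le> (\<integral>\<^sup>+x. f x \<partial>count_space A)" .
next
  show "(\<integral>\<^sup>+x. f x \<partial>count_space A) \<le> infsum f A"
  proof (cases "finite A")
    case True
    then show ?thesis by (simp add: nn_integral_count_space_finite)
  next
    case False
    have b: "bij_betw (from_nat_into A) UNIV A"
      using assms False by (rule bij_betw_from_nat_into)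
    have "(\<integral>\<^sup>+x. f x \<partial>count_space A) = (\<integral>\<^sup>+n. f (from_nat_into A n) \<partial>count_space UNIV)"
      using nn_integral_bij_count_space[OF b, of f] by simp
    also have "\<dots> = (\<Sum>n. f (from_nat_into A n))"
      by (rule nn_integral_count_space_nat)
    also have "\<dots> \<le> infsum f A"
    proof (rule suminf_le_const)
      fix n
      have inj: "inj_on (from_nat_into A) {..<n}"
        using b by (auto simp: bij_betw_def intro: inj_on_subset)
      have "(\<Sum>i<n. f (from_nat_into A i)) = sum f (from_nat_into A ` {..<n})"
        using inj by (simp add: sum.reindex)
      also have "\<dots> = infsum f (from_nat_into A ` {..<n})" by simp
      also have "\<dots> \<le> infsum f A"
        by (rule infsum_mono_neutral[OF nonneg_summable_on_complete nonneg_summable_on_complete]) (use b in \<open>auto simp: bij_betw_def simp del: infsum_finite\<close>)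
      finally show "(\<Sum>i<n. f (from_nat_into A i)) \<le> infsum f A" .
    qed auto
    finally show ?thesis .
  qed
qed

text \<open>Without absolute summability both sides are 0.\<close>

lemma infsum_real_eq_integral_count_space:
  fixes f :: "'a \<Rightarrow> real"
  shows "infsum f A = (\<integral>x. f x \<partial>count_space A)"
proof (cases "integrable (count_space A) f")
  case True
  then have "Infinite_Set_Sum.abs_summable_on f A" 
    by (simp add: Infinite_Set_Sum.abs_summable_on_def)
  then show ?thesis using infsetsum_infsum[of f A] by (simp add: infsetsum_def)
next
  case False
  then have "\<not> Infinite_Set_Sum.abs_summable_on f A" 
    by (simp add: Infinite_Set_Sum.abs_summable_on_def)
  then have "\<not> f summable_on A"
    using abs_summable_equivalent summable_on_iff_abs_summable_on_real by blast
  then show ?thesis using False by (simp add: infsum_not_exists not_integrable_integral_eq)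
qed

section \<open>Marginals of the kernel and cell averages\<close>

lemma measurable_section_update:
  assumes "F \<in> borel_measurable (lborel_on (insert i I))" "x \<in> space (lborel_on I)" "i \<notin> I"
  shows "(\<lambda>t. F (x(i := t)) :: ennreal) \<in> borel_measurable borel"
  using measurable_comp[OF measurable_component_update[OF assms(2,3)] assms(1)]
  by (simp add: comp_def)

lemma space_lborel_on_update:
  "x \<in> space (lborel_on I) \<Longrightarrow> x(i := t) \<in> space (lborel_on (insert i I))"
  by (auto simp: space_PiM PiE_def extensional_def)

lemma countable_lattice: "finite I \<Longrightarrow> countable (PiE I (\<lambda>_. UNIV :: int set))"
  by (intro countable_PiE) auto

text \<open>The line is cut into unit intervals, and each is translated to the interval from 0 to
  1.\<close>

lemma nn_integral_periodize:
  fixes h :: "real \<Rightarrow> ennreal"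
  assumes [measurable]: "h \<in> borel_measurable borel"
  shows "(\<integral>\<^sup>+t. h t \<partial>lborel)
    = (\<integral>\<^sup>+m. (\<integral>\<^sup>+s. h (s - real_of_int m) * indicator {0..1} s \<partial>lborel) \<partial>count_space UNIV)"
proof -
  \<comment> \<open>The reflection turns the translates into \<open>s - m\<close>, the sign used by
    \<open>lattice_shift\<close>.\<close>
  have b: "bij_betw uminus (UNIV :: int set) UNIV"
    by (rule bij_betwI[of _ _ _ uminus]) auto
  have "(\<integral>\<^sup>+t. h t \<partial>lborel)
    = (\<integral>\<^sup>+m. (\<integral>\<^sup>+t. h t * indicator {real_of_int m..real_of_int m + 1} t \<partial>lborel) \<partial>count_space UNIV)"
    using nn_integral_cells[of h 1] by simp
  also have "\<dots> = (\<integral>\<^sup>+m. (\<integral>\<^sup>+t. h t * indicator {real_of_int (- m)..real_of_int (- m) + 1} t \<partial>lborel) \<partial>count_space UNIV)"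
    by (rule nn_integral_bij_count_space[OF b, symmetric])
  also have "\<dots> = (\<integral>\<^sup>+m. (\<integral>\<^sup>+s. h (s - real_of_int m) * indicator {0..1} s \<partial>lborel) \<partial>count_space UNIV)"
  proof (rule nn_integral_cong)
    fix m :: int
    have "(\<integral>\<^sup>+t. h t * indicator {real_of_int (- m)..real_of_int (- m) + 1} t \<partial>lborel)
      = (\<integral>\<^sup>+s. h (1 * s - real_of_int m) * indicator {real_of_int (- m)..real_of_int (- m) + 1} (1 * s - real_of_int m) \<partial>lborel)"
      by (subst nn_integral_lborel_affine[where a = 1 and b = "real_of_int m", symmetric]) auto
    then show "(\<integral>\<^sup>+t. h t * indicator {real_of_int (- m)..real_of_int (- m) + 1} t \<partial>lborel)
      = (\<integral>\<^sup>+s. h (s - real_of_int m) * indicator {0..1} s \<partial>lborel)"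
      by (simp add: indicator_def)
  qed
  finally show ?thesis .
qed

text \<open>Integrating over one coordinate amounts to summing over its integer translates and
  averaging over a unit interval. The sum for the new marginal is thus an average of lattice sums
  one dimension higher, each at most \<open>M\<close> by induction.\<close>

lemma marginal_lattice_sum_le:
  assumes "\<psi> \<in> borel_measurable (lborel_on {..<n})"
    and "\<And>u. u \<in> space (lborel_on {..<n}) \<Longrightarrow>
      (\<integral>\<^sup>+k. \<psi> (lattice_shift {..<n} 1 u k) \<partial>count_space (PiE {..<n} (\<lambda>_. UNIV))) \<le> M"
    and "j \<le> n" "u \<in> space (lborel_on {j..<n})"
  shows "(\<integral>\<^sup>+k. emixed_iter (\<lambda>_. 1) \<psi> j (lattice_shift {j..<n} 1 u k)
      \<partial>count_space (PiE {j..<n} (\<lambda>_. UNIV))) \<le> M"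
  using assms(3,4)
proof (induction j arbitrary: u)
  case 0
  then show ?case using assms(2) by (simp add: lessThan_atLeast0)
next
  case (Suc j)
  define I where "I = {Suc j..<n}"
  have I: "{j..<n} = insert j I" "finite I" "j \<notin> I"
    using Suc.prems by (auto simp: I_def)
  define \<Psi> where "\<Psi> = emixed_iter (\<lambda>_. 1) \<psi> j"
  have u: "u \<in> space (lborel_on I)" using Suc.prems by (simp add: I_def)
  have \<Psi>: "\<Psi> \<in> borel_measurable (lborel_on (insert j I))"
    using measurable_emixed_iter[OF assms(1), of j "\<lambda>_. 1"] Suc.prems by (simp add: \<Psi>_def I)
  have [measurable]: "(\<lambda>t. \<Psi> ((lattice_shift I 1 u k)(j := t))) \<in> borel_measurable borel" for k
    by (rule measurable_section_update[OF \<Psi>]) (use I in auto)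
  have "(\<integral>\<^sup>+k. emixed_iter (\<lambda>_. 1) \<psi> (Suc j) (lattice_shift I 1 u k) \<partial>count_space (PiE I (\<lambda>_. UNIV)))
    = (\<integral>\<^sup>+k. (\<integral>\<^sup>+t. \<Psi> ((lattice_shift I 1 u k)(j := t)) \<partial>lborel) \<partial>count_space (PiE I (\<lambda>_. UNIV)))"
    by (simp add: \<Psi>_def)
  also have "\<dots> = (\<integral>\<^sup>+k. (\<integral>\<^sup>+m. (\<integral>\<^sup>+s. \<Psi> ((lattice_shift I 1 u k)(j := s - real_of_int m)) * indicator {0..1} s \<partial>lborel)
      \<partial>count_space UNIV) \<partial>count_space (PiE I (\<lambda>_. UNIV)))"
    by (subst nn_integral_periodize) auto
  also have "\<dots> = (\<integral>\<^sup>+k. (\<integral>\<^sup>+m. (\<integral>\<^sup>+s. \<Psi> (lattice_shift (insert j I) 1 (u(j := s)) (k(j := m))) * indicator {0..1} s \<partial>lborel)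
      \<partial>count_space UNIV) \<partial>count_space (PiE I (\<lambda>_. UNIV)))"
    using I by (simp add: lattice_shift_insert)
  also have "\<dots> = (\<integral>\<^sup>+k. (\<integral>\<^sup>+s. \<Psi> (lattice_shift (insert j I) 1 (u(j := s)) k) * indicator {0..1} s \<partial>lborel)
      \<partial>count_space (PiE (insert j I) (\<lambda>_. UNIV)))"
    by (rule nn_integral_count_space_PiE_insert[symmetric]) (use I in auto)
  also have "\<dots> = (\<integral>\<^sup>+s. (\<integral>\<^sup>+k. \<Psi> (lattice_shift (insert j I) 1 (u(j := s)) k) * indicator {0..1} s
      \<partial>count_space (PiE (insert j I) (\<lambda>_. UNIV))) \<partial>lborel)"
  proof (rule nn_integral_count_space_nn_integral[symmetric])
    show "countable (PiE (insert j I) (\<lambda>_. UNIV :: int set))"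
      using I by (intro countable_lattice) auto
    fix k
    have "(\<lambda>s. \<Psi> (lattice_shift (insert j I) 1 (u(j := s)) k)) \<in> borel_measurable borel"
      by (rule measurable_section_update[OF measurable_compose[OF measurable_lattice_shift \<Psi>] u]) (use I in auto)
    then show "(\<lambda>s. \<Psi> (lattice_shift (insert j I) 1 (u(j := s)) k) * indicator {0..1} s) \<in> borel_measurable lborel"
      by measurable
  qed
  also have "\<dots> \<le> (\<integral>\<^sup>+s. M * indicator {0..1} (s::real) \<partial>lborel)"
  proof (rule nn_integral_mono)
    fix s :: real
    have "(\<integral>\<^sup>+k. \<Psi> (lattice_shift (insert j I) 1 (u(j := s)) k) \<partial>count_space (PiE (insert j I) (\<lambda>_. UNIV))) \<le> M"
      unfolding \<Psi>_def
      by (rule Suc.IH[unfolded I(1), OF Suc_leD[OF Suc.prems(1)] space_lborel_on_update[OF u]])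
    then show "(\<integral>\<^sup>+k. \<Psi> (lattice_shift (insert j I) 1 (u(j := s)) k) * indicator {0..1} s
      \<partial>count_space (PiE (insert j I) (\<lambda>_. UNIV))) \<le> M * indicator {0..1} s"
      by (simp add: nn_integral_multc mult_right_mono)
  qed
  also have "\<dots> = M"
    by (simp add: nn_integral_cmult)
  finally show ?case by (simp add: I_def)
qed

text \<open>The analogue of \<open>cube\<close> for any coordinate set, for use after some
  coordinates have been integrated out.\<close>

definition cell :: "nat set \<Rightarrow> real \<Rightarrow> (nat \<Rightarrow> int) \<Rightarrow> (nat \<Rightarrow> real) set" where
  "cell I w k = PiE I (\<lambda>i. {real_of_int (k i) / w..(real_of_int (k i) + 1) / w})"

lemma sets_cell [measurable]: "finite I \<Longrightarrow> cell I w k \<in> sets (lborel_on I)"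
  unfolding cell_def by (rule sets_PiM_I_finite) auto

lemma indicator_cell_insert:
  assumes "x \<in> space (lborel_on I)" "j \<notin> I"
  shows "indicator (cell (insert j I) w (k(j := m))) (x(j := t))
    = (indicator (cell I w k) x * indicator {real_of_int m / w..(real_of_int m + 1) / w} t :: ennreal)"
proof -
  have "x(j := t) \<in> cell (insert j I) w (k(j := m)) \<longleftrightarrow>
    x \<in> cell I w k \<and> t \<in> {real_of_int m / w..(real_of_int m + 1) / w}"
    using assms by (auto simp: cell_def space_PiM PiE_iff extensional_def)
  then show ?thesis by (simp add: indicator_def)
qed

text \<open>The factor is the reciprocal of the volume of a cell of side \<open>1 / w\<close> in the
  \<open>n - j\<close> remaining coordinates. For \<open>j = n\<close> the cell is a single point,
  and the average is the whole iterated norm.\<close>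

definition cell_avg :: "nat \<Rightarrow> real \<Rightarrow> (nat \<Rightarrow> real) \<Rightarrow> ((nat \<Rightarrow> real) \<Rightarrow> ennreal) \<Rightarrow> nat \<Rightarrow> (nat \<Rightarrow> int) \<Rightarrow> ennreal" where
  "cell_avg n w p g j k = ennreal (w ^ (n - j)) *
     (\<integral>\<^sup>+x. emixed_iter p g j x * indicator (cell {j..<n} w k) x \<partial>lborel_on {j..<n})"

text \<open>Minkowski's inequality moves the sum over \<open>m\<close> inside the integral over the
  other coordinates. There Jensen's inequality on each interval of length \<open>1 / w\<close>,
  followed by summation over the intervals, yields \<open>w\<close> times an integral over the full
  line, which is a power of the next iterated norm.\<close>

lemma cell_avg_Suc:
  assumes g: "g \<in> borel_measurable (lborel_on {..<n})" and "j < n" and w: "w > 0" and p: "p j \<ge> 1"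
  shows "(\<integral>\<^sup>+m. epow (cell_avg n w p g j (k(j := m))) (p j) \<partial>count_space UNIV)
    \<le> ennreal w * epow (cell_avg n w p g (Suc j) k) (p j)"
proof -
  define I where "I = {Suc j..<n}"
  have I: "{j..<n} = insert j I" "finite I" "j \<notin> I"
    using \<open>j < n\<close> by (auto simp: I_def)
  define G where "G = emixed_iter p g j"
  have G [measurable]: "G \<in> borel_measurable (lborel_on (insert j I))"
    using measurable_emixed_iter[OF g, of j p] \<open>j < n\<close> by (simp add: G_def I)
  have [measurable]: "emixed_iter p g (Suc j) \<in> borel_measurable (lborel_on I)"
    using measurable_emixed_iter[OF g, of "Suc j" p] \<open>j < n\<close> by (simp add: I_def)
  have [measurable]: "cell I w k \<in> sets (lborel_on I)" using I by simp
  define C where "C m = {real_of_int m / w..(real_of_int m + 1) / w}" for m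
  have [measurable]: "C m \<in> sets borel" for m by (simp add: C_def)
  \<comment> \<open>The normalized indicator of the cell in the remaining coordinates; the last
    factor \<open>w\<close> goes to coordinate \<open>j\<close> inside \<open>h\<close>.\<close>
  define c where "c x = ennreal (w ^ (n - Suc j)) * indicator (cell I w k) x" for x
  have [measurable]: "c \<in> borel_measurable (lborel_on I)" unfolding c_def by measurable
  define h where "h m x = c x * (\<integral>\<^sup>+t. ennreal w * indicator (C m) t * G (x(j := t)) \<partial>lborel)" for m x
  \<comment> \<open>The root of \<open>w\<close> is chosen so that the power \<open>p j\<close> of
    \<open>N x\<close> carries the factor \<open>w\<close> left by Jensen's inequality.\<close>
  define N where "N x = c x * (ennreal (w powr (1 / p j)) * emixed_iter p g (Suc j) x)" for x
  have w_pow: "w ^ (n - j) = w ^ (n - Suc j) * w"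
    using \<open>j < n\<close> by (metis Suc_diff_Suc power_Suc2)
  have h: "cell_avg n w p g j (k(j := m)) = (\<integral>\<^sup>+x. h m x \<partial>lborel_on I)" for m
  proof -
    have [measurable]: "cell (insert j I) w (k(j := m)) \<in> sets (lborel_on (insert j I))"
      using I by simp
    have "cell_avg n w p g j (k(j := m)) = (\<integral>\<^sup>+x. ennreal (w ^ (n - j)) * (G x * indicator (cell (insert j I) w (k(j := m))) x) \<partial>lborel_on (insert j I))"
      unfolding cell_avg_def I G_def[symmetric] by (subst nn_integral_cmult) auto
    also have "\<dots> = (\<integral>\<^sup>+x. (\<integral>\<^sup>+t. ennreal (w ^ (n - j)) * (G (x(j := t)) * indicator (cell (insert j I) w (k(j := m))) (x(j := t))) \<partial>lborel) \<partial>lborel_on I)"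
      by (rule nn_integral_lborel_on_insert) (use I in auto)
    also have "\<dots> = (\<integral>\<^sup>+x. h m x \<partial>lborel_on I)"
    proof (rule nn_integral_cong)
      fix x assume x: "x \<in> space (lborel_on I)"
      have [measurable]: "(\<lambda>t. G (x(j := t))) \<in> borel_measurable borel"
        by (rule measurable_section_update[OF G x]) (use I in auto)
      have "(\<integral>\<^sup>+t. ennreal (w ^ (n - j)) * (G (x(j := t)) * indicator (cell (insert j I) w (k(j := m))) (x(j := t))) \<partial>lborel)
        = (\<integral>\<^sup>+t. c x * (ennreal w * indicator (C m) t * G (x(j := t))) \<partial>lborel)"
        using x I w by (intro nn_integral_cong)
          (simp add: indicator_cell_insert c_def C_def w_pow ennreal_mult ac_simps)
      then show "(\<integral>\<^sup>+t. ennreal (w ^ (n - j)) * (G (x(j := t)) * indicator (cell (insert j I) w (k(j := m))) (x(j := t))) \<partial>lborel) = h m x"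
        unfolding h_def by (simp add: nn_integral_cmult)
    qed
    finally show ?thesis .
  qed
  have "(\<integral>\<^sup>+m. epow (cell_avg n w p g j (k(j := m))) (p j) \<partial>count_space UNIV) \<le> epow (\<integral>\<^sup>+x. N x \<partial>lborel_on I) (p j)"
    unfolding h
  proof (rule nn_integral_minkowski)
    show "h m \<in> borel_measurable (lborel_on I)" for m
      unfolding h_def by measurable
    show "N \<in> borel_measurable (lborel_on I)"
      unfolding N_def by measurable
    fix x assume x: "x \<in> space (lborel_on I)"
    have [measurable]: "(\<lambda>t. G (x(j := t))) \<in> borel_measurable borel"
      by (rule measurable_section_update[OF G x]) (use I in auto)
    \<comment> \<open>The density \<open>w\<close> on an interval of length \<open>1 / w\<close> has
      mass 1, so Jensen's inequality holds with constant 1.\<close>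
    have "epow (h m x) (p j) \<le> epow (c x) (p j) * (\<integral>\<^sup>+t. ennreal w * indicator (C m) t * epow (G (x(j := t))) (p j) \<partial>lborel)" for m
    proof -
      have "(\<integral>\<^sup>+t. ennreal w * indicator (C m) t \<partial>lborel) \<le> ennreal 1"
      proof -
        have "(real_of_int m + 1) / w - real_of_int m / w = 1 / w"
          using w by (simp add: field_simps)
        then show ?thesis
          using w by (simp add: nn_integral_cmult C_def divide_right_mono ennreal_mult[symmetric])
      qed
      then have "epow (\<integral>\<^sup>+t. ennreal w * indicator (C m) t * G (x(j := t)) \<partial>lborel) (p j)
        \<le> ennreal (1 powr (p j - 1)) * (\<integral>\<^sup>+t. ennreal w * indicator (C m) t * epow (G (x(j := t))) (p j) \<partial>lborel)"
        by (intro nn_integral_power_mean) (use p in auto)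
      then show ?thesis
        unfolding h_def epow_mult by (intro mult_left_mono) auto
    qed
    then have "(\<integral>\<^sup>+m. epow (h m x) (p j) \<partial>count_space UNIV)
      \<le> (\<integral>\<^sup>+m. epow (c x) (p j) * (\<integral>\<^sup>+t. ennreal w * indicator (C m) t * epow (G (x(j := t))) (p j) \<partial>lborel) \<partial>count_space UNIV)"
      by (intro nn_integral_mono) auto
    also have "\<dots> = (\<integral>\<^sup>+m. epow (c x) (p j) * (ennreal w * (\<integral>\<^sup>+t. epow (G (x(j := t))) (p j) * indicator (C m) t \<partial>lborel)) \<partial>count_space UNIV)"
      by (subst nn_integral_cmult[of _ lborel "ennreal w", symmetric]) (auto simp: ac_simps)
    also have "\<dots> = epow (c x) (p j) * (ennreal w * (\<integral>\<^sup>+m. (\<integral>\<^sup>+t. epow (G (x(j := t))) (p j) * indicator (C m) t \<partial>lborel) \<partial>count_space UNIV))"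
      by (subst nn_integral_cmult, simp, subst nn_integral_cmult) auto
    also have "\<dots> = epow (c x) (p j) * (ennreal w * (\<integral>\<^sup>+t. epow (G (x(j := t))) (p j) \<partial>lborel))"
      unfolding C_def by (subst nn_integral_cells) (use w in auto)
    also have "\<dots> = epow (N x) (p j)"
      using p w by (simp add: N_def epow_mult epow_epow epow_ennreal powr_powr G_def)
    finally show "(\<integral>\<^sup>+m. epow (h m x) (p j) \<partial>count_space UNIV) \<le> epow (N x) (p j)" .
  qed (use p in auto)
  also have "(\<integral>\<^sup>+x. N x \<partial>lborel_on I) = ennreal (w powr (1 / p j)) * cell_avg n w p g (Suc j) k"
  proof -
    have "(\<integral>\<^sup>+x. N x \<partial>lborel_on I) = (\<integral>\<^sup>+x. ennreal (w powr (1 / p j)) * (ennreal (w ^ (n - Suc j)) *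
      (emixed_iter p g (Suc j) x * indicator (cell I w k) x)) \<partial>lborel_on I)"
      unfolding N_def c_def by (intro nn_integral_cong) (simp only: ac_simps)
    then show ?thesis
      unfolding cell_avg_def I_def[symmetric] by (simp add: nn_integral_cmult del: emixed_iter.simps)
  qed
  also have "epow \<dots> (p j) = ennreal w * epow (cell_avg n w p g (Suc j) k) (p j)"
    using p w by (simp add: epow_mult epow_ennreal powr_powr)
  finally show ?thesis .
qed

section \<open>The mixed-norm estimate\<close>

text \<open>Exponent 1 removes all powers from the recursion, which leaves Tonelli's theorem
  repeated \<open>j\<close> times.\<close>

lemma nn_integral_marginal:
  assumes "\<psi> \<in> borel_measurable (lborel_on {..<n})" "j \<le> n"
  shows "(\<integral>\<^sup>+x. emixed_iter (\<lambda>_. 1) \<psi> j x \<partial>lborel_on {j..<n}) = (\<integral>\<^sup>+x. \<psi> x \<partial>lborel_on {..<n})"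
  using assms(2)
proof (induction j)
  case 0
  then show ?case by (simp add: lessThan_atLeast0)
next
  case (Suc j)
  then have I: "{j..<n} = insert j {Suc j..<n}" by auto
  have "(\<integral>\<^sup>+x. emixed_iter (\<lambda>_. 1) \<psi> j x \<partial>lborel_on (insert j {Suc j..<n}))
    = (\<integral>\<^sup>+x. (\<integral>\<^sup>+t. emixed_iter (\<lambda>_. 1) \<psi> j (x(j := t)) \<partial>lborel) \<partial>lborel_on {Suc j..<n})"
    by (rule nn_integral_lborel_on_insert)
      (use measurable_emixed_iter[OF assms(1), of j "\<lambda>_. 1", unfolded I] Suc.prems in auto)
  with Suc show ?case by (simp add: I)
qed

text \<open>\<open>q\<close> shifts the exponents by one: \<open>q 0 = 1\<close> makes the case
  \<open>j = 0\<close> the definition of \<open>H\<close>, and \<open>q (Suc j) = p j\<close>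
  cancels the outer root in \<open>emixed_iter\<close>. The passage from \<open>j\<close> to
  \<open>Suc j\<close> first raises the exponent and then integrates over coordinate
  \<open>j\<close>.\<close>

lemma emixed_iter_lattice_sum_le:
  fixes w M :: real and p :: "nat \<Rightarrow> real"
  defines "q \<equiv> \<lambda>j. if j = 0 then 1 else p (j - 1)"
  assumes \<psi>: "\<psi> \<in> borel_measurable (lborel_on {..<n})" and g: "g \<in> borel_measurable (lborel_on {..<n})"
    and w: "w > 0" and M: "M > 0"
    and sum_le: "\<And>u. u \<in> space (lborel_on {..<n}) \<Longrightarrow>
      (\<integral>\<^sup>+k. \<psi> (lattice_shift {..<n} 1 u k) \<partial>count_space (PiE {..<n} (\<lambda>_. UNIV))) \<le> ennreal M"
    and p: "p 0 \<ge> 1" "\<And>i j. i \<le> j \<Longrightarrow> j < n \<Longrightarrow> p i \<le> p j"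
    and H: "\<And>x. H x = (\<integral>\<^sup>+k. \<psi> (lattice_shift {..<n} w x k) * cell_avg n w p g 0 k \<partial>count_space (PiE {..<n} (\<lambda>_. UNIV)))"
    and "j \<le> n" "x \<in> space (lborel_on {j..<n})"
  shows "epow (emixed_iter p H j x) (q j) \<le> ennreal (M powr (q j - 1)) *
    (\<integral>\<^sup>+k. emixed_iter (\<lambda>_. 1) \<psi> j (lattice_shift {j..<n} w x k) * epow (cell_avg n w p g j k) (q j)
      \<partial>count_space (PiE {j..<n} (\<lambda>_. UNIV)))"
  using assms(10,11)
proof (induction j arbitrary: x)
  case 0
  then show ?case using M by (simp add: q_def H lessThan_atLeast0)
next
  case (Suc j)
  define I where "I = {Suc j..<n}"
  have I: "{j..<n} = insert j I" "finite I" "j \<notin> I"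
    using Suc.prems by (auto simp: I_def)
  let ?Z = "\<lambda>J. PiE J (\<lambda>_. UNIV :: int set)"
  define \<Psi> where "\<Psi> = emixed_iter (\<lambda>_. 1) \<psi> j"
  define c where "c = cell_avg n w p g j"
  have x: "x \<in> space (lborel_on I)" using Suc.prems by (simp add: I_def)
  have \<Psi>: "\<Psi> \<in> borel_measurable (lborel_on (insert j I))"
    using measurable_emixed_iter[OF \<psi>, of j "\<lambda>_. 1"] Suc.prems by (simp add: \<Psi>_def I)
  have p1: "p i \<ge> 1" if "i < n" for i
    using p(1) p(2)[of 0 i] that by simp
  have pj: "p j \<ge> 1" using p1 Suc.prems by simp
  \<comment> \<open>For \<open>j > 0\<close> the second bound is the monotonicity of the exponents;
    for \<open>j = 0\<close> it is \<open>p 0 \<ge> 1\<close>.\<close>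
  have qj: "q j \<ge> 1" "q j \<le> p j"
    using p1[of "j - 1"] p(2)[of "j - 1" j] Suc.prems pj by (auto simp: q_def)
  \<comment> \<open>Jensen's inequality for the power \<open>p j / q j\<close>, with weights
    \<open>\<Psi>\<close> whose lattice sum is at most \<open>M\<close>.\<close>
  have step: "epow (emixed_iter p H j y) (p j) \<le> ennreal (M powr (p j - 1)) *
      (\<integral>\<^sup>+k. \<Psi> (lattice_shift (insert j I) w y k) * epow (c k) (p j) \<partial>count_space (?Z (insert j I)))"
    if y: "y \<in> space (lborel_on (insert j I))" for y
  proof -
    define r where "r = p j / q j"
    have r: "r \<ge> 1" "q j * r = p j" using qj by (auto simp: r_def)
    have "(\<integral>\<^sup>+k. \<Psi> (lattice_shift (insert j I) w y k) \<partial>count_space (?Z (insert j I))) \<le> ennreal M"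
    proof -
      \<comment> \<open>Rescaling the point turns scale \<open>w\<close> into scale 1, for which the
        lattice sum is bounded.\<close>
      define u where "u = (\<lambda>i\<in>insert j I. w * y i)"
      have "u \<in> space (lborel_on (insert j I))" by (auto simp: u_def space_PiM)
      moreover have "lattice_shift (insert j I) 1 u k = lattice_shift (insert j I) w y k" for k
        by (auto simp: lattice_shift_def u_def)
      ultimately show ?thesis
        using marginal_lattice_sum_le[OF \<psi> sum_le, of j u] Suc.prems by (simp add: I \<Psi>_def)
    qed
    then have mean: "epow (\<integral>\<^sup>+k. \<Psi> (lattice_shift (insert j I) w y k) * epow (c k) (q j) \<partial>count_space (?Z (insert j I))) r
      \<le> ennreal (M powr (r - 1)) * (\<integral>\<^sup>+k. \<Psi> (lattice_shift (insert j I) w y k) * epow (epow (c k) (q j)) r \<partial>count_space (?Z (insert j I)))"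
      by (intro nn_integral_power_mean) (use M r in auto)
    have "epow (emixed_iter p H j y) (p j) = epow (epow (emixed_iter p H j y) (q j)) r"
      by (simp add: epow_epow r)
    also have "\<dots> \<le> epow (ennreal (M powr (q j - 1)) *
      (\<integral>\<^sup>+k. \<Psi> (lattice_shift (insert j I) w y k) * epow (c k) (q j) \<partial>count_space (?Z (insert j I)))) r"
      using Suc.IH[of y] Suc.prems y r by (intro epow_mono) (auto simp: I \<Psi>_def c_def)
    also have "\<dots> = ennreal (M powr ((q j - 1) * r)) *
      epow (\<integral>\<^sup>+k. \<Psi> (lattice_shift (insert j I) w y k) * epow (c k) (q j) \<partial>count_space (?Z (insert j I))) r"
      by (simp add: epow_mult epow_ennreal powr_powr)
    also have "\<dots> \<le> ennreal (M powr ((q j - 1) * r)) * (ennreal (M powr (r - 1)) *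
      (\<integral>\<^sup>+k. \<Psi> (lattice_shift (insert j I) w y k) * epow (epow (c k) (q j)) r \<partial>count_space (?Z (insert j I))))"
      by (intro mult_left_mono mean) auto
    also have "\<dots> = ennreal (M powr (p j - 1)) *
      (\<integral>\<^sup>+k. \<Psi> (lattice_shift (insert j I) w y k) * epow (c k) (p j) \<partial>count_space (?Z (insert j I)))"
    proof -
      \<comment> \<open>The factor from the induction hypothesis is raised to the power
        \<open>r\<close> and meets the new \<open>M powr (r - 1)\<close>; since
        \<open>q j * r = p j\<close>, the exponents add up to \<open>p j - 1\<close>.\<close>
      have "(q j - 1) * r + (r - 1) = p j - 1" using r by (simp add: algebra_simps)
      then have "M powr ((q j - 1) * r) * M powr (r - 1) = M powr (p j - 1)"
        by (metis powr_add)
      then have "ennreal (M powr ((q j - 1) * r)) * ennreal (M powr (r - 1)) = ennreal (M powr (p j - 1))"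
        by (simp flip: ennreal_mult)
      then show ?thesis by (simp add: epow_epow r mult.assoc[symmetric])
    qed
    finally show ?thesis .
  qed
  \<comment> \<open>Substitution in coordinate \<open>j\<close> gives the next marginal times
    \<open>1 / w\<close>, independently of \<open>m\<close>. This factor later cancels the
    \<open>w\<close> of \<open>cell_avg_Suc\<close>.\<close>
  have shift_int: "(\<integral>\<^sup>+t. \<Psi> (lattice_shift (insert j I) w (x(j := t)) (k(j := m))) \<partial>lborel)
    = ennreal (1 / w) * emixed_iter (\<lambda>_. 1) \<psi> (Suc j) (lattice_shift I w x k)" for k m
  proof -
    have "(\<lambda>t. \<Psi> ((lattice_shift I w x k)(j := t))) \<in> borel_measurable borel"
      by (rule measurable_section_update[OF \<Psi>]) (use I in auto)
    from nn_integral_lborel_affine[OF this w, of "real_of_int m"]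
    have "emixed_iter (\<lambda>_. 1) \<psi> (Suc j) (lattice_shift I w x k)
      = ennreal w * (\<integral>\<^sup>+t. \<Psi> (lattice_shift (insert j I) w (x(j := t)) (k(j := m))) \<partial>lborel)"
      using I by (simp add: \<Psi>_def lattice_shift_insert)
    then show ?thesis using w by (simp add: mult.assoc[symmetric] ennreal_mult[symmetric] del: emixed_iter.simps)
  qed
  have meas: "(\<lambda>t. \<Psi> (lattice_shift (insert j I) w (x(j := t)) k)) \<in> borel_measurable borel" for k
    by (rule measurable_section_update[OF measurable_compose[OF measurable_lattice_shift \<Psi>] x]) (use I in auto)
  have "epow (emixed_iter p H (Suc j) x) (q (Suc j)) = (\<integral>\<^sup>+t. epow (emixed_iter p H j (x(j := t))) (p j) \<partial>lborel)"
    using pj by (simp add: q_def epow_epow)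
  also have "\<dots> \<le> (\<integral>\<^sup>+t. ennreal (M powr (p j - 1)) * (\<integral>\<^sup>+k. \<Psi> (lattice_shift (insert j I) w (x(j := t)) k) * epow (c k) (p j)
      \<partial>count_space (?Z (insert j I))) \<partial>lborel)"
    by (intro nn_integral_mono step space_lborel_on_update x)
  also have "\<dots> = (\<integral>\<^sup>+t. (\<integral>\<^sup>+k. ennreal (M powr (p j - 1)) * (\<Psi> (lattice_shift (insert j I) w (x(j := t)) k) * epow (c k) (p j))
      \<partial>count_space (?Z (insert j I))) \<partial>lborel)"
    by (simp add: nn_integral_cmult)
  also have "\<dots> = (\<integral>\<^sup>+k. (\<integral>\<^sup>+t. ennreal (M powr (p j - 1)) * (\<Psi> (lattice_shift (insert j I) w (x(j := t)) k) * epow (c k) (p j)) \<partial>lborel)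
      \<partial>count_space (?Z (insert j I)))"
    by (rule nn_integral_count_space_nn_integral) (use I meas in \<open>auto intro!: countable_lattice\<close>)
  also have "\<dots> = ennreal (M powr (p j - 1)) * (\<integral>\<^sup>+k. (\<integral>\<^sup>+t. \<Psi> (lattice_shift (insert j I) w (x(j := t)) k) \<partial>lborel) * epow (c k) (p j)
      \<partial>count_space (?Z (insert j I)))"
    using meas by (simp add: nn_integral_cmult nn_integral_multc)
  also have "(\<integral>\<^sup>+k. (\<integral>\<^sup>+t. \<Psi> (lattice_shift (insert j I) w (x(j := t)) k) \<partial>lborel) * epow (c k) (p j) \<partial>count_space (?Z (insert j I)))
    = (\<integral>\<^sup>+k. (\<integral>\<^sup>+m. (\<integral>\<^sup>+t. \<Psi> (lattice_shift (insert j I) w (x(j := t)) (k(j := m))) \<partial>lborel) * epow (c (k(j := m))) (p j) \<partial>count_space UNIV) \<partial>count_space (?Z I))"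
    by (rule nn_integral_count_space_PiE_insert) (use I in auto)
  also have "\<dots> = (\<integral>\<^sup>+k. emixed_iter (\<lambda>_. 1) \<psi> (Suc j) (lattice_shift I w x k) *
      (ennreal (1 / w) * (\<integral>\<^sup>+m. epow (c (k(j := m))) (p j) \<partial>count_space UNIV)) \<partial>count_space (?Z I))"
    unfolding shift_int by (simp add: nn_integral_cmult mult.assoc mult.left_commute del: emixed_iter.simps)
  also have "\<dots> \<le> (\<integral>\<^sup>+k. emixed_iter (\<lambda>_. 1) \<psi> (Suc j) (lattice_shift I w x k) *
      epow (cell_avg n w p g (Suc j) k) (p j) \<partial>count_space (?Z I))"
  proof (intro nn_integral_mono mult_left_mono)
    fix k
    have "ennreal (1 / w) * (\<integral>\<^sup>+m. epow (c (k(j := m))) (p j) \<partial>count_space UNIV)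
      \<le> ennreal (1 / w) * (ennreal w * epow (cell_avg n w p g (Suc j) k) (p j))"
      unfolding c_def by (intro mult_left_mono cell_avg_Suc g w pj) (use Suc.prems in auto)
    also have "\<dots> = epow (cell_avg n w p g (Suc j) k) (p j)"
      using w by (simp add: mult.assoc[symmetric] ennreal_mult[symmetric])
    finally show "ennreal (1 / w) * (\<integral>\<^sup>+m. epow (c (k(j := m))) (p j) \<partial>count_space UNIV) \<le> \<dots>" .
  qed auto
  finally show ?case by (simp add: q_def I_def mult_left_mono del: emixed_iter.simps)
qed

text \<open>At \<open>j = n\<close> no coordinates remain: the lattice is a single point and the
  marginal is the full integral of \<open>\<psi>\<close>. The root of order \<open>p (n - 1)\<close>
  finishes the estimate.\<close>

lemma emixed_iter_lattice_sum_le_norm: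
  fixes w M :: real and p :: "nat \<Rightarrow> real"
  assumes "n \<ge> 1" and \<psi>: "\<psi> \<in> borel_measurable (lborel_on {..<n})" and g: "g \<in> borel_measurable (lborel_on {..<n})"
    and w: "w > 0" and M: "M > 0"
    and sum_le: "\<And>u. u \<in> space (lborel_on {..<n}) \<Longrightarrow>
      (\<integral>\<^sup>+k. \<psi> (lattice_shift {..<n} 1 u k) \<partial>count_space (PiE {..<n} (\<lambda>_. UNIV))) \<le> ennreal M"
    and p: "p 0 \<ge> 1" "\<And>i j. i \<le> j \<Longrightarrow> j < n \<Longrightarrow> p i \<le> p j"
    and H: "\<And>x. H x = (\<integral>\<^sup>+k. \<psi> (lattice_shift {..<n} w x k) * cell_avg n w p g 0 k \<partial>count_space (PiE {..<n} (\<lambda>_. UNIV)))"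
  shows "emixed_iter p H n (\<lambda>_. undefined) \<le> ennreal (M powr (1 - 1 / p (n - 1))) *
    epow (\<integral>\<^sup>+u. \<psi> u \<partial>lborel_on {..<n}) (1 / p (n - 1)) * emixed_iter p g n (\<lambda>_. undefined)"
proof -
  let ?o = "\<lambda>_::nat. undefined"
  define P where "P = p (n - 1)"
  have P: "P \<ge> 1" using p(1) p(2)[of 0 "n - 1"] \<open>n \<ge> 1\<close> by (simp add: P_def)
  have shift: "lattice_shift {} w x k = ?o" for x k
    by (simp add: lattice_shift_def restrict_def)
  have int_\<psi>: "emixed_iter (\<lambda>_. 1) \<psi> n ?o = (\<integral>\<^sup>+u. \<psi> u \<partial>lborel_on {..<n})"
    using nn_integral_marginal[OF \<psi>, of n] by (simp add: PiM_empty nn_integral_count_space_finite)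
  have avg: "cell_avg n w p g n k = emixed_iter p g n ?o" for k
    by (simp add: cell_avg_def PiM_empty nn_integral_count_space_finite cell_def)
  have "epow (emixed_iter p H n ?o) P \<le> ennreal (M powr (P - 1)) *
     ((\<integral>\<^sup>+u. \<psi> u \<partial>lborel_on {..<n}) * epow (emixed_iter p g n ?o) P)"
    using emixed_iter_lattice_sum_le[OF \<psi> g w M sum_le p H, of n ?o] \<open>n \<ge> 1\<close>
    by (simp add: P_def space_PiM nn_integral_count_space_finite shift int_\<psi> avg)
  then have "epow (epow (emixed_iter p H n ?o) P) (1 / P) \<le> epow (ennreal (M powr (P - 1)) *
     ((\<integral>\<^sup>+u. \<psi> u \<partial>lborel_on {..<n}) * epow (emixed_iter p g n ?o) P)) (1 / P)"
    using P by (intro epow_mono) auto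
  moreover have "(P - 1) / P = 1 - 1 / P" using P by (simp add: diff_divide_distrib)
  ultimately show ?thesis
    unfolding P_def[symmetric] using P by (simp add: epow_epow epow_mult epow_ennreal powr_powr mult.assoc)
qed

section \<open>Kernels and the sampling operator\<close>

text \<open>Modification on a null set preserves measurability in the completion. This applies to
  \<open>kantorovich\<close>, which agrees almost everywhere with a Borel function.\<close>

lemma borel_measurable_completion_cong_AE:
  assumes g: "g \<in> borel_measurable M" and ae: "AE x in M. f x = g x"
  shows "f \<in> borel_measurable (completion M)"
proof (rule measurableI)
  fix A :: "'b set" assume A: "A \<in> sets borel"
  show "f -` A \<inter> space (completion M) \<in> sets (completion M)"
  proof (rule completion.in_sets_AE)
    show "AE x in completion M. x \<in> g -` A \<inter> space M \<longleftrightarrow> x \<in> f -` A \<inter> space (completion M)"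
      using AE_completion[OF ae] by eventually_elim auto
    show "g -` A \<inter> space M \<in> sets (completion M)"
      using measurable_sets[OF g A] by auto
  qed auto
qed auto

text \<open>A countable discrete factor reduces joint measurability to that of each slice.\<close>

lemma measurable_pair_count_space2:
  assumes "countable A" and [measurable]: "\<And>k. k \<in> A \<Longrightarrow> (\<lambda>x. f (x, k)) \<in> N \<rightarrow>\<^sub>M K"
  shows "f \<in> N \<Otimes>\<^sub>M count_space A \<rightarrow>\<^sub>M K"
  using _ _ assms(1)
  by (rule measurable_compose_countable'[where f = "\<lambda>a b. f (fst b, a)" and g = snd and I = A, simplified]) simp_all

lemma lattice_shift_lattice_shift:
  "lattice_shift I 1 (lattice_shift I 1 u j) k = lattice_shift I 1 u (\<lambda>i\<in>I. j i + k i)"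
  by (auto simp: lattice_shift_def)

text \<open>Translation by a lattice vector permutes the lattice; this makes periodizations lattice
  invariant.\<close>

lemma nn_integral_lattice_translate:
  fixes F :: "(nat \<Rightarrow> int) \<Rightarrow> ennreal"
  shows "(\<integral>\<^sup>+k. F (\<lambda>i\<in>I. j i + k i) \<partial>count_space (PiE I (\<lambda>_. UNIV))) = (\<integral>\<^sup>+k. F k \<partial>count_space (PiE I (\<lambda>_. UNIV)))"
proof (rule nn_integral_bij_count_space)
  show "bij_betw (\<lambda>k. \<lambda>i\<in>I. j i + k i) (PiE I (\<lambda>_. UNIV :: int set)) (PiE I (\<lambda>_. UNIV))"
    by (rule bij_betwI[where g = "\<lambda>k. \<lambda>i\<in>I. k i - j i"])
      (auto simp: PiE_def extensional_def fun_eq_iff)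
qed

section \<open>Finiteness and positivity of the zeroth moment\<close>

lemma moment_0_eq:
  "moment n 0 \<kappa> = (SUP u \<in> space (lborel_on {..<n}).
     \<integral>\<^sup>+k. ennreal \<bar>\<kappa> (vsub n u k)\<bar> \<partial>count_space (Zn n))"
  unfolding moment_def lebn_def
  by (simp add: infsum_ennreal_eq_nn_integral Zn_def countable_lattice)

text \<open>Both lattice points lie within 1/2 of \<open>u\<close> in each coordinate, hence their
  integer coordinates differ by less than 1.\<close>

lemma eucl_norm_less_half_unique:
  assumes "k \<in> Zn n" "l \<in> Zn n" "eucl_norm n (vsub n u k) < 1 / 2" "eucl_norm n (vsub n u l) < 1 / 2"
  shows "k = l"
proof
  fix i
  show "k i = l i"
  proof (cases "i < n")
    case True
    have *: "\<bar>u i - real_of_int (k i)\<bar> < 1 / 2" if "eucl_norm n (vsub n u k) < 1 / 2" for k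
    proof -
      have "\<bar>vsub n u k i\<bar> = L2_set (vsub n u k) {i}" by simp
      also have "\<dots> \<le> eucl_norm n (vsub n u k)"
        unfolding eucl_norm_def L2_set_def using True by (intro real_sqrt_le_mono sum_mono2) auto
      finally show ?thesis using that True by (simp add: vsub_def)
    qed
    have "\<bar>real_of_int (k i) - real_of_int (l i)\<bar> < 1"
      using *[OF assms(3)] *[OF assms(4)] by linarith
    then show ?thesis by linarith
  qed (use assms in \<open>auto simp: Zn_def PiE_def extensional_def\<close>)
qed

text \<open>Near the origin the kernel is bounded and at most one lattice translate lies there; elsewhere
  the \<open>\<alpha>\<close>-moment dominates.\<close>

lemma moment_0_finite:
  assumes ker: "is_kernel n \<alpha> \<kappa>" and "\<alpha> \<ge> 0"
  shows "moment n 0 \<kappa> < \<infinity>"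
proof (cases "\<alpha> = 0")
  case True
  then show ?thesis using ker by (simp add: is_kernel_def)
next
  case False
  let ?Z = "count_space (Zn n)"
  have Z: "countable (Zn n)" by (simp add: Zn_def countable_lattice)
  obtain \<delta> B where \<delta>: "\<delta> > 0" and B: "\<And>u. u \<in> space (lebn n) \<Longrightarrow> eucl_norm n u < \<delta> \<Longrightarrow> \<bar>\<kappa> u\<bar> \<le> B"
    using ker unfolding is_kernel_def by blast
  \<comment> \<open>Below \<open>\<delta>\<close> the kernel is bounded by \<open>B\<close>; below
    1/2 at most one lattice translate can occur.\<close>
  define d where "d = min \<delta> (1 / 2)"
  have d: "d > 0" using \<delta> by (simp add: d_def)
  have bound: "(\<integral>\<^sup>+k. ennreal \<bar>\<kappa> (vsub n u k)\<bar> \<partial>?Z) \<le> ennreal B + ennreal (1 / d powr \<alpha>) * moment n \<alpha> \<kappa>"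
    if u: "u \<in> space (lborel_on {..<n})" for u
  proof -
    define S where "S = {k \<in> Zn n. eucl_norm n (vsub n u k) < d}"
    let ?T = "\<lambda>k. ennreal (\<bar>\<kappa> (vsub n u k)\<bar> * eucl_norm n (vsub n u k) powr \<alpha>)"
    have S: "emeasure ?Z S \<le> 1"
    proof (cases "S = {}")
      case False
      then obtain l where l: "l \<in> S" by blast
      then have "S = {l}"
        using eucl_norm_less_half_unique[of _ n l u] by (auto simp: S_def d_def)
      moreover have "l \<in> Zn n" using l by (simp add: S_def)
      ultimately show ?thesis by simp
    qed simp
    have "(\<integral>\<^sup>+k. ennreal \<bar>\<kappa> (vsub n u k)\<bar> \<partial>?Z) \<le> (\<integral>\<^sup>+k. ennreal B * indicator S k + ennreal (1 / d powr \<alpha>) * ?T k \<partial>?Z)"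
    proof (rule nn_integral_mono)
      fix k assume "k \<in> space ?Z"
      then have k: "k \<in> Zn n" by simp
      show "ennreal \<bar>\<kappa> (vsub n u k)\<bar> \<le> ennreal B * indicator S k + ennreal (1 / d powr \<alpha>) * ?T k"
      proof (cases "k \<in> S")
        case True
        have "vsub n u k \<in> space (lebn n)" by (auto simp: lebn_def vsub_def space_PiM)
        with True B have "\<bar>\<kappa> (vsub n u k)\<bar> \<le> B" by (auto simp: S_def d_def)
        with True show ?thesis by (simp add: ennreal_leI add_increasing2)
      next
        \<comment> \<open>Here the norm is at least \<open>d\<close>, so the weight divided by
          \<open>d powr \<alpha>\<close> is at least 1.\<close>
        case False
        then have "d \<le> eucl_norm n (vsub n u k)" using k by (simp add: S_def)
        then have "d powr \<alpha> \<le> eucl_norm n (vsub n u k) powr \<alpha>"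
          using d \<open>\<alpha> \<ge> 0\<close> by (intro powr_mono2) auto
        then have "\<bar>\<kappa> (vsub n u k)\<bar> * (d powr \<alpha> / d powr \<alpha>) \<le> \<bar>\<kappa> (vsub n u k)\<bar> * (eucl_norm n (vsub n u k) powr \<alpha> / d powr \<alpha>)"
          by (intro mult_left_mono divide_right_mono) auto
        then have "\<bar>\<kappa> (vsub n u k)\<bar> \<le> 1 / d powr \<alpha> * (\<bar>\<kappa> (vsub n u k)\<bar> * eucl_norm n (vsub n u k) powr \<alpha>)"
          using d by (simp add: field_simps)
        then have "ennreal \<bar>\<kappa> (vsub n u k)\<bar> \<le> ennreal (1 / d powr \<alpha>) * ?T k"
          by (subst ennreal_mult[symmetric]) (auto intro: ennreal_leI)
        then show ?thesis using False by simp
      qed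
    qed
    also have "\<dots> = ennreal B * emeasure ?Z S + ennreal (1 / d powr \<alpha>) * (\<integral>\<^sup>+k. ?T k \<partial>?Z)"
      by (simp add: nn_integral_add nn_integral_cmult S_def)
    also have "\<dots> \<le> ennreal B * 1 + ennreal (1 / d powr \<alpha>) * moment n \<alpha> \<kappa>"
    proof (intro add_mono mult_left_mono S)
      show "(\<integral>\<^sup>+k. ?T k \<partial>?Z) \<le> moment n \<alpha> \<kappa>"
        unfolding moment_def infsum_ennreal_eq_nn_integral[OF Z]
        by (rule SUP_upper2[of u]) (use u False in \<open>auto simp: lebn_def\<close>)
    qed auto
    finally show ?thesis by simp
  qed
  have "moment n 0 \<kappa> \<le> ennreal B + ennreal (1 / d powr \<alpha>) * moment n \<alpha> \<kappa>"
    unfolding moment_0_eq by (rule SUP_least) (rule bound)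
  also have "\<dots> < \<infinity>"
    using ker by (simp add: is_kernel_def ennreal_mult_less_top)
  finally show ?thesis .
qed

text \<open>If the zeroth moment vanished, all terms at the origin would be 0, contrary to their sum
  being 1. Jensen's inequality asks for a positive mass bound.\<close>

lemma moment_0_pos:
  assumes "is_kernel n \<alpha> \<kappa>"
  shows "moment n 0 \<kappa> > 0"
proof (rule ccontr)
  assume "\<not> moment n 0 \<kappa> > 0"
  then have 0: "moment n 0 \<kappa> = 0" by simp
  define u :: "nat \<Rightarrow> real" where "u = (\<lambda>i\<in>{..<n}. 0)"
  have u: "u \<in> space (lborel_on {..<n})" by (auto simp: u_def space_PiM)
  have "(\<integral>\<^sup>+k. ennreal \<bar>\<kappa> (vsub n u k)\<bar> \<partial>count_space (Zn n)) \<le> moment n 0 \<kappa>"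
    unfolding moment_0_eq by (rule SUP_upper[OF u])
  then have "\<forall>k\<in>Zn n. \<kappa> (vsub n u k) = 0"
    unfolding 0 by (subst (asm) le_zero_eq, subst (asm) nn_integral_0_iff_AE) (auto simp: AE_count_space ennreal_eq_0_iff)
  then have "((\<lambda>k. \<kappa> (vsub n u k)) has_sum 0) (Zn n)"
    by (intro has_sum_0) auto
  moreover have "((\<lambda>k. \<kappa> (vsub n u k)) has_sum 1) (Zn n)"
    using assms u by (auto simp: is_kernel_def lebn_def)
  ultimately show False using has_sum_unique by fastforce
qed

text \<open>The periodization of a Borel representative is lattice invariant and almost everywhere at most the
  zeroth moment. Cutting the representative off where this fails makes the bound hold everywhere.\<close>

lemma borel_kernel_majorant:
  assumes \<kappa>: "\<kappa> \<in> borel_measurable (lebn n)"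
  obtains \<psi> where "\<psi> \<in> borel_measurable (lborel_on {..<n})"
    and "AE u in lborel_on {..<n}. \<psi> u = ennreal \<bar>\<kappa> u\<bar>"
    and "\<And>u. u \<in> space (lborel_on {..<n}) \<Longrightarrow>
      (\<integral>\<^sup>+k. \<psi> (lattice_shift {..<n} 1 u k) \<partial>count_space (PiE {..<n} (\<lambda>_. UNIV))) \<le> moment n 0 \<kappa>"
proof -
  let ?Z = "count_space (PiE {..<n} (\<lambda>_. UNIV :: int set))"
  have Z: "countable (PiE {..<n} (\<lambda>_. UNIV :: int set))" by (simp add: countable_lattice)
  obtain \<kappa>' where [measurable]: "\<kappa>' \<in> borel_measurable (lborel_on {..<n})"
    and \<kappa>': "AE u in lborel_on {..<n}. \<kappa> u = \<kappa>' u"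
    using completion_ex_borel_measurable_real[OF \<kappa>[unfolded lebn_def]] by blast
  define S where "S u = (\<integral>\<^sup>+k. ennreal \<bar>\<kappa>' (lattice_shift {..<n} 1 u k)\<bar> \<partial>?Z)" for u
  have [measurable]: "S \<in> borel_measurable (lborel_on {..<n})"
  proof -
    interpret sigma_finite_measure ?Z
      using Z by (rule sigma_finite_measure_count_space_countable)
    have "(\<lambda>(u, k). ennreal \<bar>\<kappa>' (lattice_shift {..<n} 1 u k)\<bar>) \<in> borel_measurable (lborel_on {..<n} \<Otimes>\<^sub>M ?Z)"
      by (rule measurable_pair_count_space2[OF Z]) simp
    then show ?thesis unfolding S_def by (rule borel_measurable_nn_integral)
  qed
  define E where "E = {u \<in> space (lborel_on {..<n}). S u \<le> moment n 0 \<kappa>}"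
  have E [measurable]: "E \<in> sets (lborel_on {..<n})" unfolding E_def by measurable
  have S_shift: "S (lattice_shift {..<n} 1 u k) = S u" for u k
    unfolding S_def lattice_shift_lattice_shift
    by (rule nn_integral_lattice_translate[where F = "\<lambda>k. ennreal \<bar>\<kappa>' (lattice_shift {..<n} 1 u k)\<bar>"])
  have E_shift: "lattice_shift {..<n} 1 u k \<in> E \<longleftrightarrow> S u \<le> moment n 0 \<kappa>" for u k
    by (simp add: E_def S_shift)
  show thesis
  proof
    show "(\<lambda>u. ennreal \<bar>\<kappa>' u\<bar> * indicator E u) \<in> borel_measurable (lborel_on {..<n})"
      by measurable
    \<comment> \<open>The lattice is countable, so one null set serves all translates, and off it
      the periodization of \<open>\<kappa>'\<close> is that of \<open>\<kappa>\<close>.\<close>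
    have "AE u in lborel_on {..<n}. \<forall>k\<in>PiE {..<n} (\<lambda>_. UNIV :: int set).
        \<kappa> (lattice_shift {..<n} 1 u k) = \<kappa>' (lattice_shift {..<n} 1 u k)"
      unfolding AE_ball_countable[OF Z]
      by (intro ballI AE_lattice_shift[where P = "\<lambda>u. \<kappa> u = \<kappa>' u"] \<kappa>') auto
    with \<kappa>' AE_space show "AE u in lborel_on {..<n}. ennreal \<bar>\<kappa>' u\<bar> * indicator E u = ennreal \<bar>\<kappa> u\<bar>"
    proof eventually_elim
      case (elim u)
      have "S u = (\<integral>\<^sup>+k. ennreal \<bar>\<kappa> (vsub n u k)\<bar> \<partial>count_space (Zn n))"
        unfolding S_def Zn_def using elim(3) by (intro nn_integral_cong) (simp add: vsub_eq_lattice_shift_1)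
      also have "\<dots> \<le> moment n 0 \<kappa>"
        unfolding moment_0_eq by (rule SUP_upper[OF elim(2)])
      finally show ?case using elim by (simp add: E_def)
    qed
    fix u assume "u \<in> space (lborel_on {..<n})"
    show "(\<integral>\<^sup>+k. ennreal \<bar>\<kappa>' (lattice_shift {..<n} 1 u k)\<bar> * indicator E (lattice_shift {..<n} 1 u k) \<partial>?Z) \<le> moment n 0 \<kappa>"
    \<comment> \<open>Membership of a translate in \<open>E\<close> does not depend on
      \<open>k\<close>, so the cutoff keeps all terms of the sum or none.\<close>
    proof (cases "S u \<le> moment n 0 \<kappa>")
      case True
      then show ?thesis by (simp add: indicator_def E_shift S_def)
    next
      case False
      then show ?thesis by (simp add: indicator_def E_shift)
    qed
  qed
qed

section \<open>Measurability and pointwise domination of the operator\<close>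

lemma abs_integral_le_nn_integral:
  fixes f :: "'a \<Rightarrow> real"
  shows "ennreal \<bar>\<integral>x. f x \<partial>M\<bar> \<le> (\<integral>\<^sup>+x. ennreal \<bar>f x\<bar> \<partial>M)"
  using integral_norm_bound_ennreal[of M f]
  \<comment> \<open>Without integrability the left side is 0 by the convention for the Bochner
    integral.\<close>
  by (cases "integrable M f") (auto simp: not_integrable_integral_eq)

text \<open>Only countably many values of the kernel enter at each point, so passing to a Borel
  representative changes the operator on a null set only. The resulting series is a parameter
  integral over counting measure.\<close>

lemma borel_measurable_kantorovich:
  assumes \<kappa>: "\<kappa> \<in> borel_measurable (lebn n)" and w: "w > 0"
  shows "kantorovich n w \<kappa> f \<in> borel_measurable (lebn n)"
proof -
  let ?Z = "count_space (Zn n)"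
  have Z: "countable (Zn n)" by (simp add: Zn_def countable_lattice)
  obtain \<kappa>' where [measurable]: "\<kappa>' \<in> borel_measurable (lborel_on {..<n})"
    and \<kappa>': "AE u in lborel_on {..<n}. \<kappa> u = \<kappa>' u"
    using completion_ex_borel_measurable_real[OF \<kappa>[unfolded lebn_def]] by blast
  define a where "a k = (LINT t : cube n w k | lebn n. f t)" for k
  show ?thesis
    unfolding lebn_def
  proof (rule borel_measurable_completion_cong_AE)
    interpret sigma_finite_measure ?Z
      using Z by (rule sigma_finite_measure_count_space_countable)
    have "(\<lambda>(x, k). \<kappa>' (lattice_shift {..<n} w x k) * w ^ n * a k) \<in> borel_measurable (lborel_on {..<n} \<Otimes>\<^sub>M ?Z)"
      by (rule measurable_pair_count_space2[OF Z]) simp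
    then show "(\<lambda>x. \<integral>k. \<kappa>' (lattice_shift {..<n} w x k) * w ^ n * a k \<partial>?Z) \<in> borel_measurable (lborel_on {..<n})"
      by (rule borel_measurable_lebesgue_integral)
    have "AE x in lborel_on {..<n}. \<forall>k\<in>Zn n. \<kappa> (lattice_shift {..<n} w x k) = \<kappa>' (lattice_shift {..<n} w x k)"
      unfolding AE_ball_countable[OF Z]
      by (intro ballI AE_lattice_shift[where P = "\<lambda>u. \<kappa> u = \<kappa>' u"] \<kappa>' w) auto
    then show "AE x in lborel_on {..<n}. kantorovich n w \<kappa> f x = (\<integral>k. \<kappa>' (lattice_shift {..<n} w x k) * w ^ n * a k \<partial>?Z)"
      by eventually_elim
        (auto simp: kantorovich_def infsum_real_eq_integral_count_space vsub_eq_lattice_shift a_def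
          intro!: Bochner_Integration.integral_cong)
  qed
qed

text \<open>The triangle inequality for the series and for each cell integral. The factor
  \<open>w ^ n\<close> turns the cell integral into an average; at index 0 it is the plain average
  of \<open>g\<close>, whatever the exponents.\<close>

lemma kantorovich_abs_le:
  assumes \<psi>: "AE u in lborel_on {..<n}. \<psi> u = ennreal \<bar>\<kappa> u\<bar>"
    and g: "AE t in lborel_on {..<n}. g t = ennreal \<bar>f t\<bar>" and w: "w > 0"
  shows "AE x in lborel_on {..<n}. ennreal \<bar>kantorovich n w \<kappa> f x\<bar>
    \<le> (\<integral>\<^sup>+k. \<psi> (lattice_shift {..<n} w x k) * cell_avg n w p g 0 k \<partial>count_space (PiE {..<n} (\<lambda>_. UNIV)))"
proof -
  let ?Z = "count_space (Zn n)"
  have Z: "countable (Zn n)" by (simp add: Zn_def countable_lattice)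
  define a where "a k = (LINT t : cube n w k | lebn n. f t)" for k
  have a: "ennreal (w ^ n) * ennreal \<bar>a k\<bar> \<le> cell_avg n w p g 0 k" for k
  proof -
    have "ennreal \<bar>a k\<bar> \<le> (\<integral>\<^sup>+t. ennreal \<bar>indicator (cube n w k) t * f t\<bar> \<partial>lebn n)"
      unfolding a_def set_lebesgue_integral_def by (simp add: abs_integral_le_nn_integral)
    also have "\<dots> = (\<integral>\<^sup>+t. ennreal \<bar>indicator (cube n w k) t * f t\<bar> \<partial>lborel_on {..<n})"
      by (simp add: lebn_def nn_integral_completion)
    also have "\<dots> = (\<integral>\<^sup>+t. g t * indicator (cell {..<n} w k) t \<partial>lborel_on {..<n})"
    proof (rule nn_integral_cong_AE)
      show "AE t in lborel_on {..<n}. ennreal \<bar>indicator (cube n w k) t * f t\<bar> = g t * indicator (cell {..<n} w k) t"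
        using g by eventually_elim (simp add: cube_def cell_def indicator_def)
    qed
    finally show ?thesis
      by (simp add: cell_avg_def mult_left_mono lessThan_atLeast0)
  qed
  have "AE x in lborel_on {..<n}. \<forall>k\<in>Zn n. \<psi> (lattice_shift {..<n} w x k) = ennreal \<bar>\<kappa> (lattice_shift {..<n} w x k)\<bar>"
    unfolding AE_ball_countable[OF Z]
    by (intro ballI AE_lattice_shift[where P = "\<lambda>u. \<psi> u = ennreal \<bar>\<kappa> u\<bar>"] \<psi> w) auto
  then show ?thesis
  proof eventually_elim
    case (elim x)
    have "kantorovich n w \<kappa> f x = (\<integral>k. \<kappa> (lattice_shift {..<n} w x k) * w ^ n * a k \<partial>?Z)"
      by (simp add: kantorovich_def infsum_real_eq_integral_count_space vsub_eq_lattice_shift a_def)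
    then have "ennreal \<bar>kantorovich n w \<kappa> f x\<bar> \<le> (\<integral>\<^sup>+k. ennreal \<bar>\<kappa> (lattice_shift {..<n} w x k) * w ^ n * a k\<bar> \<partial>?Z)"
      by (simp add: abs_integral_le_nn_integral)
    also have "\<dots> \<le> (\<integral>\<^sup>+k. \<psi> (lattice_shift {..<n} w x k) * cell_avg n w p g 0 k \<partial>?Z)"
    proof (rule nn_integral_mono)
      fix k assume "k \<in> space ?Z"
      then have "\<psi> (lattice_shift {..<n} w x k) = ennreal \<bar>\<kappa> (lattice_shift {..<n} w x k)\<bar>"
        using elim by simp
      moreover have "ennreal \<bar>\<kappa> (lattice_shift {..<n} w x k) * w ^ n * a k\<bar>
        = ennreal \<bar>\<kappa> (lattice_shift {..<n} w x k)\<bar> * (ennreal (w ^ n) * ennreal \<bar>a k\<bar>)"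
        using w by (simp add: abs_mult ennreal_mult mult.assoc)
      ultimately show "ennreal \<bar>\<kappa> (lattice_shift {..<n} w x k) * w ^ n * a k\<bar>
        \<le> \<psi> (lattice_shift {..<n} w x k) * cell_avg n w p g 0 k"
        using a by (simp add: mult_left_mono)
    qed
    finally show ?case by (simp add: Zn_def)
  qed
qed

text \<open>After \<open>n\<close> steps the space is a single point, where almost everywhere means
  everywhere.\<close>

lemma emixed_iter_mono_AE_full:
  assumes "AE x in lborel_on {..<n}. F x \<le> G x" "\<And>i. i < n \<Longrightarrow> p i > 0"
  shows "emixed_iter p F n (\<lambda>_. undefined) \<le> emixed_iter p G n (\<lambda>_. undefined)"
  using emixed_iter_mono_AE[OF assms order_refl]
  unfolding atLeastLessThan_empty[OF order_refl] PiM_empty AE_count_space by simp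

theorem theorem4p2:
  fixes n :: nat and w \<alpha> :: real and p :: "nat \<Rightarrow> real"
    and \<kappa> f :: "(nat \<Rightarrow> real) \<Rightarrow> real"
  assumes "n \<ge> 1" and "w > 0" and "\<alpha> \<ge> 0"
    and "p 0 \<ge> 1" and "\<And>i j. i \<le> j \<Longrightarrow> j < n \<Longrightarrow> p i \<le> p j"
    and "is_kernel n \<alpha> \<kappa>"
    and "f \<in> mixed_Lp n p"
  shows "kantorovich n w \<kappa> f \<in> mixed_Lp n p \<and>
    mixed_norm n p (kantorovich n w \<kappa> f)
      \<le> ennreal (enn2real (moment n 0 \<kappa>) powr (1 - 1 / p (n - 1))
                 * (LINT u | lebn n. \<bar>\<kappa> u\<bar>) powr (1 / p (n - 1)))
        * mixed_norm n p f"
proof -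
  let ?L = "lborel_on {..<n}"
  define M where "M = enn2real (moment n 0 \<kappa>)"
  \<comment> \<open>The moment is positive and finite, so passing to a real number loses
    nothing.\<close>
  have M: "M > 0" "ennreal M = moment n 0 \<kappa>"
    using moment_0_pos[OF assms(6)] moment_0_finite[OF assms(6,3)]
    by (auto simp: M_def enn2real_positive_iff)
  have \<kappa>: "integrable (lebn n) \<kappa>" using assms(6) by (simp add: is_kernel_def)
  then have \<kappa>_meas: "\<kappa> \<in> borel_measurable (lebn n)" by simp
  obtain \<psi> where \<psi>: "\<psi> \<in> borel_measurable ?L" "AE u in ?L. \<psi> u = ennreal \<bar>\<kappa> u\<bar>"
    and sum_le: "\<And>u. u \<in> space ?L \<Longrightarrow>
      (\<integral>\<^sup>+k. \<psi> (lattice_shift {..<n} 1 u k) \<partial>count_space (PiE {..<n} (\<lambda>_. UNIV))) \<le> ennreal M"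
    using borel_kernel_majorant[OF \<kappa>_meas] unfolding M(2) by blast
  have f: "f \<in> borel_measurable (completion ?L)" "mixed_norm n p f < \<infinity>"
    using assms(7) by (auto simp: mixed_Lp_def lebn_def)
  obtain f' where f': "f' \<in> borel_measurable ?L" "AE t in ?L. f t = f' t"
    using completion_ex_borel_measurable_real[OF f(1)] by auto
  define g where "g t = ennreal \<bar>f' t\<bar>" for t
  have g: "g \<in> borel_measurable ?L" unfolding g_def using f'(1) by measurable
  have g_eq: "AE t in ?L. g t = ennreal \<bar>f t\<bar>"
    using f'(2) by eventually_elim (simp add: g_def)
  \<comment> \<open>The non-negative majorant of the operator to which the mixed-norm estimate
    applies.\<close>
  define H where "H x = (\<integral>\<^sup>+k. \<psi> (lattice_shift {..<n} w x k) * cell_avg n w p g 0 k \<partial>count_space (PiE {..<n} (\<lambda>_. UNIV)))" for x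
  have p_pos: "p i > 0" if "i < n" for i
    using assms(4) assms(5)[of 0 i] that by simp
  have "mixed_norm n p (kantorovich n w \<kappa> f) \<le> emixed_iter p H n (\<lambda>_. undefined)"
    unfolding mixed_norm_def mixed_iter_eq_emixed_iter H_def[abs_def]
    by (intro emixed_iter_mono_AE_full kantorovich_abs_le \<psi>(2) g_eq \<open>w > 0\<close> p_pos)
  also have "\<dots> \<le> ennreal (M powr (1 - 1 / p (n - 1))) *
    epow (\<integral>\<^sup>+u. \<psi> u \<partial>?L) (1 / p (n - 1)) * emixed_iter p g n (\<lambda>_. undefined)"
    by (rule emixed_iter_lattice_sum_le_norm[OF \<open>n \<ge> 1\<close> \<psi>(1) g \<open>w > 0\<close> M(1) sum_le assms(4,5) H_def])
  also have "(\<integral>\<^sup>+u. \<psi> u \<partial>?L) = ennreal (LINT u | lebn n. \<bar>\<kappa> u\<bar>)"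
  proof -
    have "(\<integral>\<^sup>+u. \<psi> u \<partial>?L) = (\<integral>\<^sup>+u. ennreal \<bar>\<kappa> u\<bar> \<partial>lebn n)"
      unfolding lebn_def nn_integral_completion using \<psi>(2) by (rule nn_integral_cong_AE)
    also have "\<dots> = ennreal (LINT u | lebn n. \<bar>\<kappa> u\<bar>)"
      using \<kappa> by (intro nn_integral_eq_integral) auto
    finally show ?thesis .
  qed
  \<comment> \<open>The return from the Borel representative to \<open>f\<close>, by monotonicity
    almost everywhere.\<close>
  also have "emixed_iter p g n (\<lambda>_. undefined) \<le> mixed_norm n p f"
  proof -
    have "AE t in ?L. g t \<le> ennreal \<bar>f t\<bar>" using g_eq by eventually_elim simp
    then show ?thesis
      unfolding mixed_norm_def mixed_iter_eq_emixed_iter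
      by (rule emixed_iter_mono_AE_full) (rule p_pos)
  qed
  finally have le: "mixed_norm n p (kantorovich n w \<kappa> f)
      \<le> ennreal (M powr (1 - 1 / p (n - 1)) * (LINT u | lebn n. \<bar>\<kappa> u\<bar>) powr (1 / p (n - 1))) * mixed_norm n p f"
    by (simp add: epow_ennreal ennreal_mult mult_left_mono)
  then have "mixed_norm n p (kantorovich n w \<kappa> f) < \<infinity>"
    using f(2) by (auto simp: ennreal_mult_less_top intro: le_less_trans)
  with le show ?thesis
    using borel_measurable_kantorovich[OF \<kappa>_meas \<open>w > 0\<close>] by (auto simp: mixed_Lp_def M_def)
qed

end
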